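(* The subgroups $\rho(\pi_1(HOV))$ and $\rho(\pi_1(\mathcal W\cap\mathcal H^{\bf C}))$, together with the shift $\sigma$, generate a proper subgroup of $\mathrm{Aut}(\Sigma_2)$. (Fundamental groups are taken at a common base point $*\in HOV\cap\mathcal W\cap{\bf R}^2$ with negative first coordinate.)
   Context: For $(a,b)\in{\bf C}^2$ with $b\ne0$ let $f_{a,b}(x,y)=(x^2+a-by,\,x)$ on ${\bf C}^2$, and $K_{a,b}=\{p\in{\bf C}^2:\{f_{a,b}^n(p):n\in{\bf Z}\}\text{ is bounded}\}$. $\Sigma_2=\{0,1\}^{\bf Z}$ with the shift $\sigma$ is the full 2-shift; $\mathrm{Aut}(\Sigma_2)$ is the group of homeomorphisms of $\Sigma_2$ commuting with $\sigma$. The complex horseshoe locus $\mathcal H^{\bf C}$ is the (open) set of $(a,b)\in{\bf C}^2$, $b\ne 0$, such that $f_{a,b}|_{K_{a,b}}$ is hyperbolic and topologically conjugate to $(\Sigma_2,\sigma)$. It contains $HOV=\{(a,b)\in{\bf C}^2:|a|>2(|b|+1)^2,\ b\neq0\}$. Monodromy representation: for $*=(a_0,b_0)\in HOV\cap{\bf R}^2$ with $a_0<0$, $K_*\subset{\bf R}^2$ misses $\{x=0\}$, and $c_*:K_*\to\Sigma_2$ is the conjugacy whose $n$-th symbol at $p$ is $0$ or $1$ according as the $x$-coordinate of $f_*^n(p)$ is negative or positive. For a path $\gamma:[0,1]\to\mathcal H^{\bf C}$ there is a unique continuous family of topological conjugacies $g_t:K_{\gamma(0)}\to K_{\gamma(t)}$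 with $g_0=\mathrm{id}$; put $\alpha(\gamma)=g_1$. For a loop $\gamma$ in $\mathcal H^{\bf C}$ based at $*$, $\rho(\gamma)=c_*\circ\alpha(\gamma)\circ c_*^{-1}\in\mathrm{Aut}(\Sigma_2)$ depends only on the homotopy class of $\gamma$. For a subset $U\subset\mathcal H^{\bf C}$ containing $*$, $\rho(\pi_1(U))$ denotes the set of $\rho(\gamma)$ with $\gamma$ a loop in $U$ based at $*$. The region $\mathcal W$. Let $g_a(z)=z^2+a$ and let $\mathcal W_{(1)}=\{a\in{\bf C}:|a|+2\,\mathrm{Re}\,a+1<0\}$ (the region containing $(-\infty,-1)$ bounded by the arch through $-1$ of the hyperbola $a^2+a\in\sqrt a\,{\bf R}$). For $a=|a|e^{i\phi}\in\mathcal W_{(1)}$, $\phi\in(0,2\pi)$, and $R,t>0$, define - $W_0=\{|z-a|<R^2\}\setminus\{se^{i\phi}:s\ge|a|\}$ (disk with a radial slit removed), - $W_1=\{|z-a|<R^2,\ \mathrm{Im}(e^{-i\phi/2}z)>-t\}$, - $D_0=\{0<|z|<R,\ \mathrm{Im}(e^{-i\phi/2}z)<0\}$, $D_2=\{0<|z|<R,\ \mathrm{Im}(e^{-i\phi/2}z)>0\}$, $D_1=g_a^{-1}(W_1)$. Let $\mathcal G$ be the directed graph on the vertices $0,1,2$ with edges $0\to0$, $0\to1$, $1\to2$, $2\to0$, $2\to1$, and $\Sigma_{\mathcal G}$ the set of bi-infinite sequences in $\{0,1,2\}$ following edges of $\mathcal G$. For $\epsilon>0$ let $\mathrm{Orb}(\epsilon)$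 be the set of sequences $(p_n)_{n\in{\bf Z}}$ in $D_0\cup D_1\cup D_2$ with $|p_{n+1}-g_a(p_n)|<\epsilon$ for all $n$, and $\hat X(\epsilon)=\{(p_n,i_n)_{n\in{\bf Z}}:(p_n)\in\mathrm{Orb}(\epsilon),\ (i_n)\in\Sigma_{\mathcal G},\ p_n\in D_{i_n}\ \forall n\}$. Fix $R,t,\epsilon>0$ depending continuously on $a\in\mathcal W_{(1)}$, with $\epsilon$ sufficiently small, such that: $\overline{D_0}\cup\overline{D_1}\subset W_0$ and $\overline{D_2}\subset W_1$; every element of $\mathrm{Orb}(\epsilon)$ is the first component of some element of $\hat X(\epsilon)$; there is $\delta>0$ such that if $(p_n,i_n)\in\hat X(\epsilon)$ and $(q_n)\in\mathrm{Orb}(\epsilon)$ is $\delta$-close to $(p_n)$ (i.e. $|q_n-p_n|<\delta$ for all $n$) then $(q_n,i_n)\in\hat X(\epsilon)$; and $K_{a,b}\subset\{|x|<R,|y|<R\}$ whenever $0<|b|<\epsilon/R$. Then $\mathcal W=\{(a,b)\in{\bf C}^2: a\in\mathcal W_{(1)},\ 0<|b|<\epsilon/R\}$. *)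

theory Defs
  imports "HOL-Analysis.Analysis" "HOL-Algebra.Generated_Groups"
begin

section \<open>Integer iterates, conjugacies, hyperbolic sets\<close>

text \<open>Only used for bijections \<open>f\<close>; the negative iterates are those of \<^term>\<open>inv_into UNIV f\<close>.\<close>

definition iter :: "('a \<Rightarrow> 'a) \<Rightarrow> int \<Rightarrow> 'a \<Rightarrow> 'a" where
  "iter f n = (if 0 \<le> n then f ^^ nat n else inv_into UNIV f ^^ nat (- n))"

definition conjugacy ::
  "'a::topological_space set \<Rightarrow> ('a \<Rightarrow> 'a) \<Rightarrow> 'b::topological_space set \<Rightarrow> ('b \<Rightarrow> 'b) \<Rightarrow> ('a \<Rightarrow> 'b) \<Rightarrow> bool" where
  "conjugacy X f Y g h \<longleftrightarrow>
     (\<exists>k. homeomorphism X Y h k) \<and> (\<forall>x\<in>X. h (f x) = g (h x))"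

text \<open>
  The standard notion of a (uniformly) hyperbolic set of a diffeomorphism \<open>f\<close>. Continuity
  of the splitting \<open>Es \<oplus> Eu\<close> is a consequence of the estimates; so is the fact that for
  holomorphic \<open>f\<close> the (a priori real) subspaces \<open>Es p\<close> and \<open>Eu p\<close> are complex.
\<close>

definition hyperbolic_set :: "('a::euclidean_space \<Rightarrow> 'a) \<Rightarrow> 'a set \<Rightarrow> bool" where
  "hyperbolic_set f K \<longleftrightarrow> compact K \<and> f ` K = K \<and>
     (\<exists>Es Eu C l. 0 < C \<and> 0 < l \<and> l < 1 \<and>
       (\<forall>p\<in>K.
          subspace (Es p) \<and> subspace (Eu p) \<and>
          Es p \<inter> Eu p = {0} \<and> (\<forall>v. \<exists>s\<in>Es p. \<exists>u\<in>Eu p. v = s + u) \<and>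
          frechet_derivative f (at p) ` Es p = Es (f p) \<and>
          frechet_derivative f (at p) ` Eu p = Eu (f p) \<and>
          (\<forall>n::nat. \<forall>v\<in>Es p. norm (frechet_derivative (iter f (int n)) (at p) v) \<le> C * l ^ n * norm v) \<and>
          (\<forall>n::nat. \<forall>v\<in>Eu p. norm (frechet_derivative (iter f (- int n)) (at p) v) \<le> C * l ^ n * norm v)))"


section \<open>The full 2-shift and its automorphism group\<close>

text \<open>
  The symbols 0 and 1 are encoded as \<^term>\<open>False\<close> and \<^term>\<open>True\<close>. The library topology on
  \<^typ>\<open>int \<Rightarrow> bool\<close> is the product of the discrete topologies.
\<close>

type_synonym sigma2 = "int \<Rightarrow> bool"

definition shift :: "sigma2 \<Rightarrow> sigma2" where
  "shift s = (\<lambda>n. s (n + 1))"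

definition Aut_sigma2 :: "(sigma2 \<Rightarrow> sigma2) monoid" where
  "Aut_sigma2 =
     \<lparr>carrier = {\<phi>. (\<exists>\<psi>. homeomorphism UNIV UNIV \<phi> \<psi>) \<and> \<phi> \<circ> shift = shift \<circ> \<phi>},
      monoid.mult = (\<circ>), one = id\<rparr>"


section \<open>Complex Henon maps and the horseshoe locus\<close>

definition henon :: "complex \<times> complex \<Rightarrow> complex \<times> complex \<Rightarrow> complex \<times> complex" where
  "henon = (\<lambda>(a, b) (x, y). (x^2 + a - b * y, x))"

definition K :: "complex \<times> complex \<Rightarrow> (complex \<times> complex) set" where
  "K c = {p. bounded (range (\<lambda>n. iter (henon c) n p))}"

definition horseshoe_locus :: "(complex \<times> complex) set" where
  "horseshoe_locus =
     {(a, b). b \<noteq> 0 \<and> hyperbolic_set (henon (a, b)) (K (a, b)) \<and>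
        (\<exists>h. conjugacy (K (a, b)) (henon (a, b)) UNIV shift h)}"

definition HOV :: "(complex \<times> complex) set" where
  "HOV = {(a, b). cmod a > 2 * (cmod b + 1)^2 \<and> b \<noteq> 0}"


section \<open>Monodromy\<close>

text \<open>
  The symbolic coding. It is meant for parameters in \<^term>\<open>HOV\<close> that are real with negative
  first component; there all points of \<^term>\<open>K c\<close> are real, so \<^term>\<open>Re\<close> only
  converts the type.
\<close>

definition coding :: "complex \<times> complex \<Rightarrow> complex \<times> complex \<Rightarrow> sigma2" where
  "coding c p = (\<lambda>n. 0 < Re (fst (iter (henon c) n p)))"

definition conjugacy_family ::
  "(real \<Rightarrow> complex \<times> complex) \<Rightarrow> (real \<Rightarrow> complex \<times> complex \<Rightarrow> complex \<times> complex) \<Rightarrow> bool" where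
  "conjugacy_family \<gamma> g \<longleftrightarrow>
     (\<forall>t\<in>{0..1}. conjugacy (K (\<gamma> 0)) (henon (\<gamma> 0)) (K (\<gamma> t)) (henon (\<gamma> t)) (g t)) \<and>
     continuous_on ({0..1} \<times> K (\<gamma> 0)) (\<lambda>(t, p). g t p) \<and>
     (\<forall>p\<in>K (\<gamma> 0). g 0 p = p)"

text \<open>
  \<open>monodromy \<gamma> \<phi>\<close> says \<open>\<phi> = \<rho>(\<gamma>)\<close>. It is stated as the graph of \<open>\<rho>\<close>, because \<open>\<rho>\<close> is a
  function only by the theorem that for \<open>\<gamma>\<close> in the horseshoe locus the family \<open>g\<close> exists
  and is unique on \<^term>\<open>K (\<gamma> 0)\<close>.
\<close>

definition monodromy :: "(real \<Rightarrow> complex \<times> complex) \<Rightarrow> (sigma2 \<Rightarrow> sigma2) \<Rightarrow> bool" where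
  "monodromy \<gamma> \<phi> \<longleftrightarrow>
     (\<exists>g. conjugacy_family \<gamma> g \<and>
        \<phi> = coding (\<gamma> 0) \<circ> g 1 \<circ> inv_into (K (\<gamma> 0)) (coding (\<gamma> 0)))"

definition rho_pi1 :: "complex \<times> complex \<Rightarrow> (complex \<times> complex) set \<Rightarrow> (sigma2 \<Rightarrow> sigma2) set" where
  "rho_pi1 c U =
     {\<phi>. \<exists>\<gamma>. path \<gamma> \<and> path_image \<gamma> \<subseteq> U \<and> pathstart \<gamma> = c \<and> pathfinish \<gamma> = c \<and> monodromy \<gamma> \<phi>}"


section \<open>The region W\<close>

definition quad :: "complex \<Rightarrow> complex \<Rightarrow> complex" where
  "quad a z = z^2 + a"

definition Wbase :: "complex set" where
  "Wbase = {a. cmod a + 2 * Re a + 1 < 0}"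

text \<open>
  \<open>Im (e\<^sup>-\<^sup>i\<^sup>\<phi>\<^sup>/\<^sup>2 z)\<close> for \<open>a = |a| e\<^sup>i\<^sup>\<phi>\<close>. No element of \<^term>\<open>Wbase\<close> lies on
  the ray \<open>[0, \<infinity>)\<close>, so there \<^term>\<open>Arg2pi a\<close> is the \<open>\<phi>\<close> in \<open>(0, 2\<pi>)\<close>.
\<close>

definition height :: "complex \<Rightarrow> complex \<Rightarrow> real" where
  "height a z = Im (cis (- (Arg2pi a / 2)) * z)"

definition W0 :: "complex \<Rightarrow> real \<Rightarrow> complex set" where
  "W0 a R = {z. cmod (z - a) < R^2} - {of_real s * cis (Arg2pi a) | s. s \<ge> cmod a}"

definition W1 :: "complex \<Rightarrow> real \<Rightarrow> real \<Rightarrow> complex set" where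
  "W1 a R t = {z. cmod (z - a) < R^2 \<and> height a z > - t}"

definition D :: "complex \<Rightarrow> real \<Rightarrow> real \<Rightarrow> nat \<Rightarrow> complex set" where
  "D a R t i =
     (if i = 0 then {z. 0 < cmod z \<and> cmod z < R \<and> height a z < 0}
      else if i = 1 then quad a -` W1 a R t
      else if i = 2 then {z. 0 < cmod z \<and> cmod z < R \<and> height a z > 0}
      else {})"

definition Sigma_G :: "(int \<Rightarrow> nat) set" where
  "Sigma_G = {i. \<forall>n. (i n, i (n + 1)) \<in> {(0,0), (0,1), (1,2), (2,0), (2,1)}}"

definition Orb :: "complex \<Rightarrow> real \<Rightarrow> real \<Rightarrow> real \<Rightarrow> (int \<Rightarrow> complex) set" where
  "Orb a R t \<epsilon> =
     {p. \<forall>n. p n \<in> D a R t 0 \<union> D a R t 1 \<union> D a R t 2 \<and> cmod (p (n + 1) - quad a (p n)) < \<epsilon>}"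

definition Xhat :: "complex \<Rightarrow> real \<Rightarrow> real \<Rightarrow> real \<Rightarrow> ((int \<Rightarrow> complex) \<times> (int \<Rightarrow> nat)) set" where
  "Xhat a R t \<epsilon> = {(p, i). p \<in> Orb a R t \<epsilon> \<and> i \<in> Sigma_G \<and> (\<forall>n. p n \<in> D a R t (i n))}"

definition admissible_at :: "complex \<Rightarrow> real \<Rightarrow> real \<Rightarrow> real \<Rightarrow> bool" where
  "admissible_at a R t \<epsilon> \<longleftrightarrow>
     R > 0 \<and> t > 0 \<and> \<epsilon> > 0 \<and>
     closure (D a R t 0) \<union> closure (D a R t 1) \<subseteq> W0 a R \<and>
     closure (D a R t 2) \<subseteq> W1 a R t \<and>
     (\<forall>p\<in>Orb a R t \<epsilon>. \<exists>i. (p, i) \<in> Xhat a R t \<epsilon>) \<and>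
     (\<exists>\<delta>>0. \<forall>p i q. (p, i) \<in> Xhat a R t \<epsilon> \<and> q \<in> Orb a R t \<epsilon> \<and> (\<forall>n. cmod (q n - p n) < \<delta>)
         \<longrightarrow> (q, i) \<in> Xhat a R t \<epsilon>) \<and>
     (\<forall>b. 0 < cmod b \<and> cmod b < \<epsilon> / R \<longrightarrow> K (a, b) \<subseteq> {(x, y). cmod x < R \<and> cmod y < R})"

text \<open>
  A choice of \<open>R\<close>, \<open>t\<close>, \<open>\<epsilon>\<close> as functions of \<open>a\<close>. That \<open>\<epsilon>\<close> is sufficiently small means that it
  is small enough for the properties in \<^term>\<open>admissible_at\<close> to hold.
\<close>

definition admissible :: "(complex \<Rightarrow> real) \<Rightarrow> (complex \<Rightarrow> real) \<Rightarrow> (complex \<Rightarrow> real) \<Rightarrow> bool" where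
  "admissible R t \<epsilon> \<longleftrightarrow>
     continuous_on Wbase R \<and> continuous_on Wbase t \<and> continuous_on Wbase \<epsilon> \<and>
     (\<forall>a\<in>Wbase. admissible_at a (R a) (t a) (\<epsilon> a))"

definition W_region :: "(complex \<Rightarrow> real) \<Rightarrow> (complex \<Rightarrow> real) \<Rightarrow> (complex \<times> complex) set" where
  "W_region R \<epsilon> = {(a, b). a \<in> Wbase \<and> 0 < cmod b \<and> cmod b < \<epsilon> a / R a}"

end

(* The invariant is a partition of the twelve points of least period 4 of the full 2-shift into
   two classes of six points.

   Along a path in HOV, x^2 stays in the disk of radius |a| about -a for all points of K, so whether
   two points have the same symbol does not change: a monodromy of HOV is the identity or
   exchanges the symbols 0 and 1, and it preserves both classes.

   Along a path in W, a periodic orbit whose itinerary in Sigma_G contains a 0 has no other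
   itinerary, while admitting a given itinerary is an open condition; hence the itinerary is constant
   along the path. Such orbits are dense, so for every point s and every monodromy rho some
   itinerary is compatible on a given window with both s and rho(s). For points of period 4
   this forces s and rho(s) into the same class.

   The shift exchanges the two classes. The involution that replaces the symbol * in every 0*110
   maps 1110 to the other class and fixes 0100, so it is not in the generated subgroup.

   That the monodromies are automorphisms at all requires the coding to be a conjugacy. An orbit
   with symbols s_n is a fixed point of x_n = +-sqrt(x_(n+1) + b x_(n-1) - a), and by the
   Schwarz-Pick lemma on the bidisc the right-hand side contracts the pseudo-hyperbolic distance of
   a disk. *)

theory Submission
  imports Defs "HOL-Complex_Analysis.Riemann_Mapping"
begin

section \<open>Integer orbits\<close>

lemma iter_zero [simp]: "iter f 0 p = p"
  by (simp add: iter_def)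

lemma iter_add_one:
  assumes "bij f"
  shows "iter f (n + 1) p = f (iter f n p)"
proof (cases "0 \<le> n")
  case True
  then show ?thesis
    by (simp add: iter_def nat_add_distrib)
next
  case False
  define k where "k = nat (- n) - 1"
  have n: "n = - int k - 1" and k: "nat (- n) = Suc k"
    using False by (auto simp: k_def)
  have "iter f (n + 1) p = (inv_into UNIV f ^^ k) p"
    by (cases k) (simp_all add: n iter_def nat_add_distrib)
  moreover have "iter f n p = inv_into UNIV f ((inv_into UNIV f ^^ k) p)"
    using False k by (simp add: iter_def)
  ultimately show ?thesis
    using assms by (simp add: bij_is_surj surj_f_inv_f)
qed

text \<open>Injectivity of \<open>f\<close> carries the uniqueness of a two-sided orbit to negative
  times.\<close>

lemma iter_eqI:
  assumes "bij f" "\<And>n. y (n + 1) = f (y n)"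
  shows "y n = iter f n (y 0)"
proof (induction n rule: int_induct [where k = 0])
  case base
  show ?case by simp
next
  case (step1 i)
  then show ?case
    by (simp add: assms iter_add_one)
next
  case (step2 i)
  have "f (y (i - 1)) = f (iter f (i - 1) (y 0))"
    using assms(2)[of "i - 1"] iter_add_one[OF assms(1), of "i - 1" "y 0"] step2 by simp
  then show ?case
    using assms(1) by (simp add: bij_is_inj inj_eq)
qed

lemma iter_add:
  assumes "bij f"
  shows "iter f (m + n) p = iter f m (iter f n p)"
  using iter_eqI[OF assms, of "\<lambda>m. iter f (m + n) p" m] iter_add_one[OF assms, of "_ + n" p]
  by (simp add: algebra_simps)

section \<open>Henon orbits as solutions of a scalar recurrence of order two\<close>

lemma henon_fst [simp]: "fst (henon c (x, y)) = x\<^sup>2 + fst c - snd c * y"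
  by (cases c) (simp add: henon_def)

lemma henon_snd [simp]: "snd (henon c p) = fst p"
  by (cases c, cases p) (simp add: henon_def)

lemma bij_henon:
  assumes "snd c \<noteq> 0"
  shows "bij (henon c)"
proof -
  obtain a b where c: "c = (a, b)" by fastforce
  let ?g = "\<lambda>(u, v). (v, (v\<^sup>2 + a - u) / b)"
  have "?g \<circ> henon c = id" "henon c \<circ> ?g = id"
    using assms by (auto simp: c henon_def fun_eq_iff)
  then show ?thesis by (rule o_bij)
qed

text \<open>The second coordinate of a Henon orbit is the previous first coordinate, so this scalar
  sequence encodes the whole orbit.\<close>

definition xcoord :: "complex \<times> complex \<Rightarrow> complex \<times> complex \<Rightarrow> int \<Rightarrow> complex" where
  "xcoord c p n = fst (iter (henon c) n p)"

lemma coding_eq: "coding c p n \<longleftrightarrow> 0 < Re (xcoord c p n)"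
  by (simp add: coding_def xcoord_def)

lemma iter_henon_eq:
  assumes "snd c \<noteq> 0"
  shows "iter (henon c) n p = (xcoord c p n, xcoord c p (n - 1))"
proof -
  have "iter (henon c) n p = henon c (iter (henon c) (n - 1) p)"
    using iter_add_one[OF bij_henon[OF assms], of "n - 1" p] by simp
  then have "snd (iter (henon c) n p) = xcoord c p (n - 1)"
    by (metis henon_snd xcoord_def)
  then show ?thesis
    by (metis prod.collapse xcoord_def)
qed

lemma xcoord_rec:
  assumes "snd c \<noteq> 0"
  shows "xcoord c p (n + 1) = (xcoord c p n)\<^sup>2 + fst c - snd c * xcoord c p (n - 1)"
proof -
  have "xcoord c p (n + 1) = fst (henon c (xcoord c p n, xcoord c p (n - 1)))"
    unfolding xcoord_def[of c p "n + 1"] iter_add_one[OF bij_henon[OF assms]]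
    by (simp only: iter_henon_eq[OF assms])
  then show ?thesis
    by (simp only: henon_fst)
qed

text \<open>Turns a solution of the recurrence back into an orbit; points with prescribed symbols
  are built in this way.\<close>

lemma xcoord_eqI:
  assumes "snd c \<noteq> 0" "\<And>n. x (n + 1) = (x n)\<^sup>2 + fst c - snd c * x (n - 1)"
  shows "xcoord c (x 0, x (- 1)) n = x n"
proof -
  define y where "y n = (x n, x (n - 1))" for n
  have "y (n + 1) = henon c (y n)" for n
    using assms(2)[of n] by (intro prod_eqI) (simp_all add: y_def)
  from iter_eqI[where y = y, OF bij_henon[OF assms(1)] this, of n] show ?thesis
    by (metis y_def xcoord_def fst_conv diff_0)
qed

lemma xcoord_iter:
  assumes "snd c \<noteq> 0"
  shows "xcoord c (iter (henon c) m p) n = xcoord c p (n + m)"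
  using iter_add[OF bij_henon[OF assms]] by (simp add: xcoord_def)

lemma mem_K_iff:
  assumes "snd c \<noteq> 0"
  shows "p \<in> K c \<longleftrightarrow> bounded (range (xcoord c p))"
proof
  assume "p \<in> K c"
  then have "bounded (fst ` range (\<lambda>n. iter (henon c) n p))"
    by (simp add: K_def bounded_fst)
  then show "bounded (range (xcoord c p))"
    by (simp add: image_image xcoord_def [abs_def])
next
  assume "bounded (range (xcoord c p))"
  then have "bounded (range (xcoord c p) \<times> range (xcoord c p))"
    by (simp add: bounded_Times)
  moreover have "range (\<lambda>n. iter (henon c) n p) \<subseteq> range (xcoord c p) \<times> range (xcoord c p)"
    using iter_henon_eq[OF assms] by auto
  ultimately show "p \<in> K c"
    using bounded_subset by (auto simp: K_def)
qed

lemma iter_in_K: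
  assumes "snd c \<noteq> 0" "p \<in> K c"
  shows "iter (henon c) m p \<in> K c"
proof -
  have "range (xcoord c (iter (henon c) m p)) \<subseteq> range (xcoord c p)"
    using xcoord_iter[OF assms(1)] by auto
  then show ?thesis
    using assms bounded_subset by (auto simp: mem_K_iff)
qed

lemma henon_in_K:
  assumes "snd c \<noteq> 0" "p \<in> K c"
  shows "henon c p \<in> K c"
  using iter_in_K[OF assms, of 1] iter_add_one[OF bij_henon[OF assms(1)], of 0 p] by simp

lemma conjugacy_iter:
  assumes "conjugacy (K c) (henon c) (K c') (henon c') h" "snd c \<noteq> 0" "snd c' \<noteq> 0" "p \<in> K c"
  shows "h (iter (henon c) n p) = iter (henon c') n (h p)"
proof -
  have "h (iter (henon c) (n + 1) p) = henon c' (h (iter (henon c) n p))" for n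
    using assms iter_in_K[OF assms(2,4)] iter_add_one[OF bij_henon[OF assms(2)]]
    by (simp add: conjugacy_def)
  from iter_eqI[where y = "\<lambda>n. h (iter (henon c) n p)", OF bij_henon[OF assms(3)] this] show ?thesis by simp
qed

lemma coding_henon:
  assumes "snd c \<noteq> 0"
  shows "coding c (henon c p) = shift (coding c p)"
proof
  fix n
  have "henon c p = iter (henon c) 1 p"
    using iter_add_one[OF bij_henon[OF assms], of 0 p] by simp
  then show "coding c (henon c p) n = shift (coding c p) n"
    using xcoord_iter[OF assms] by (simp add: coding_eq shift_def)
qed

lemma continuous_on_xcoord:
  assumes "snd c \<noteq> 0"
  shows "continuous_on UNIV (\<lambda>p. xcoord c p n)"
proof -
  obtain a b where c: "c = (a, b)" by fastforce
  have "henon c = (\<lambda>p. ((fst p)\<^sup>2 + a - b * snd p, fst p))"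
    by (auto simp: c henon_def)
  then have h: "continuous_on UNIV (henon c)"
    by (simp add: continuous_intros)
  have inv: "inv_into UNIV (henon c) = (\<lambda>p. (snd p, ((snd p)\<^sup>2 + a - fst p) / b))"
  proof (rule inv_equality)
    show "(case henon c p of q \<Rightarrow> (snd q, ((snd q)\<^sup>2 + a - fst q) / b)) = p" for p
      using assms by (cases p) (simp add: c henon_def)
    show "henon c (snd p, ((snd p)\<^sup>2 + a - fst p) / b) = p" for p
      using assms by (cases p) (simp add: c henon_def)
  qed
  have i: "continuous_on UNIV (inv_into UNIV (henon c))"
    using assms unfolding inv by (intro continuous_intros) (auto simp: c)
  have pow: "continuous_on UNIV (f ^^ k)" if "continuous_on UNIV f"
    for f :: "complex \<times> complex \<Rightarrow> complex \<times> complex" and k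
    by (induction k) (auto simp: comp_def intro: continuous_on_compose2[OF that])
  have "continuous_on UNIV (iter (henon c) n)"
    using pow[OF h] pow[OF i] by (simp add: iter_def)
  then show ?thesis
    unfolding xcoord_def by (intro continuous_on_fst) (simp add: eta_contract_eq)
qed

section \<open>An escape radius\<close>

text \<open>Here \<alpha> and \<beta> stand for |a| and 1 + |b|. The bound \<beta> R < \<alpha>
  keeps x^2 within distance |a| of -a; the other one confines bounded orbits to the disk of radius
  R.\<close>

lemma escape_radius:
  fixes \<alpha> \<beta> :: real
  assumes "1 \<le> \<beta>" "2 * \<beta>\<^sup>2 < \<alpha>"
  obtains R where "0 < R" "\<beta> * R < \<alpha>" "\<alpha> + \<beta> * R < R\<^sup>2"
proof
  \<comment> \<open>With this radius both inequalities reduce to 2 \<beta>^2 < \<alpha>.\<close>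
  let ?R = "\<alpha> / (2 * \<beta>) + \<beta>"
  have \<alpha>: "0 < \<alpha>"
    using assms by (smt (verit) zero_le_power2)
  show "0 < ?R"
    using assms \<alpha> by (simp add: add_pos_pos)
  have e: "\<beta> * ?R = \<alpha> / 2 + \<beta>\<^sup>2"
    using assms by (simp add: field_simps power2_eq_square)
  show "\<beta> * ?R < \<alpha>"
    using assms e by simp
  have "?R\<^sup>2 = \<alpha> * (\<alpha> / (4 * \<beta>\<^sup>2)) + \<alpha> + \<beta>\<^sup>2"
    using assms by (simp add: field_simps power2_eq_square)
  moreover have "1 / 2 < \<alpha> / (4 * \<beta>\<^sup>2)"
    using assms by (simp add: field_simps)
  then have "\<alpha> * (1 / 2) < \<alpha> * (\<alpha> / (4 * \<beta>\<^sup>2))"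
    using \<alpha> mult_less_cancel_left_pos by blast
  ultimately show "\<alpha> + \<beta> * ?R < ?R\<^sup>2"
    using e by simp
qed

text \<open>The supremum S of the moduli satisfies S^2 \<le> |a| + (1 + |b|) S, while R satisfies
  the opposite strict inequality; this forces S \<le> R.\<close>

lemma bounded_orbit_bound:
  fixes x :: "int \<Rightarrow> complex"
  assumes bdd: "bounded (range x)"
    and rec: "\<And>n. x (n + 1) = (x n)\<^sup>2 + a - b * x (n - 1)"
    and R: "0 < R" "cmod a + (1 + cmod b) * R < R\<^sup>2"
  shows "cmod (x n) < R"
proof (rule power_less_imp_less_base)
  define S where "S = (SUP n. cmod (x n))"
  have bd: "bdd_above (range (\<lambda>n. cmod (x n)))"
    using bdd by (auto simp: bounded_iff bdd_above_def)
  have le: "cmod (x n) \<le> S" for n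
    unfolding S_def using bd by (intro cSUP_upper) auto
  then have S0: "0 \<le> S"
    using norm_ge_zero order_trans by blast
  have sq: "(cmod (x n))\<^sup>2 \<le> cmod a + (1 + cmod b) * S" for n
  proof -
    have "(x n)\<^sup>2 = x (n + 1) + b * x (n - 1) - a"
      using rec[of n] by simp
    then have "cmod ((x n)\<^sup>2) \<le> cmod (x (n + 1)) + cmod b * cmod (x (n - 1)) + cmod a"
      using norm_triangle_ineq4[of "x (n + 1) + b * x (n - 1)" a]
        norm_triangle_ineq[of "x (n + 1)" "b * x (n - 1)"]
      by (simp add: norm_mult)
    also have "\<dots> \<le> S + cmod b * S + cmod a"
      by (intro add_mono mult_left_mono le) auto
    finally show ?thesis
      by (simp add: norm_power algebra_simps)
  qed
  have "S \<le> sqrt (cmod a + (1 + cmod b) * S)"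
    unfolding S_def[of] by (rule cSUP_least) (use sq real_le_rsqrt in \<open>auto simp: S_def\<close>)
  then have "S\<^sup>2 \<le> cmod a + (1 + cmod b) * S"
    using S0 by (metis real_sqrt_le_iff real_sqrt_abs abs_of_nonneg)
  then have 1: "S * (S - (1 + cmod b)) \<le> cmod a"
    by (simp add: power2_eq_square algebra_simps)
  have 2: "cmod a < R * (R - (1 + cmod b))"
    using R by (simp add: power2_eq_square algebra_simps)
  have 3: "0 < R - (1 + cmod b)"
  proof (rule ccontr)
    assume "\<not> ?thesis"
    then have "R * (R - (1 + cmod b)) \<le> 0"
      using R(1) by (intro mult_nonneg_nonpos) auto
    with 2 norm_ge_zero[of a] show False by linarith
  qed
  have "S \<le> R"
  proof (rule ccontr)
    assume "\<not> S \<le> R"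
    then have "R * (R - (1 + cmod b)) \<le> S * (S - (1 + cmod b))"
      using 3 R(1) by (intro mult_mono) auto
    with 1 2 show False by simp
  qed
  \<comment> \<open>Inserting S \<le> R into the quadratic bound once more makes the result
    strict.\<close>
  then have "(1 + cmod b) * S \<le> (1 + cmod b) * R"
    by (intro mult_left_mono) auto
  then show "(cmod (x n))\<^sup>2 < R\<^sup>2"
    using sq[of n] R(2) by linarith
qed (use R in auto)

text \<open>By the recurrence x_n^2 + a equals x_(n+1) + b x_(n-1), whose modulus is at most (1 +
  |b|) R < |a|. Hence the squares avoid 0.\<close>

lemma K_square_bound:
  assumes "c \<in> HOV" "p \<in> K c"
  shows "cmod ((xcoord c p n)\<^sup>2 + fst c) < cmod (fst c)"
proof -
  have b: "snd c \<noteq> 0" and a: "2 * (1 + cmod (snd c))\<^sup>2 < cmod (fst c)"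
    using assms(1) by (auto simp: HOV_def algebra_simps)
  obtain R where R: "0 < R" "(1 + cmod (snd c)) * R < cmod (fst c)"
    "cmod (fst c) + (1 + cmod (snd c)) * R < R\<^sup>2"
    using escape_radius[of "1 + cmod (snd c)" "cmod (fst c)"] a by auto
  have x: "cmod (xcoord c p n) \<le> R" for n
    using bounded_orbit_bound[where x = "xcoord c p", OF _ xcoord_rec[OF b] R(1,3)]
      assms(2) mem_K_iff[OF b] by (simp add: less_imp_le)
  have "(xcoord c p n)\<^sup>2 + fst c = xcoord c p (n + 1) + snd c * xcoord c p (n - 1)"
    using xcoord_rec[OF b, of p n] by simp
  then have "cmod ((xcoord c p n)\<^sup>2 + fst c)
      \<le> cmod (xcoord c p (n + 1)) + cmod (snd c) * cmod (xcoord c p (n - 1))"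
    by (metis norm_mult norm_triangle_ineq)
  also have "\<dots> \<le> R + cmod (snd c) * R"
    by (intro add_mono mult_left_mono x) auto
  also have "\<dots> < cmod (fst c)"
    using R(2) by (simp add: algebra_simps)
  finally show ?thesis .
qed

section \<open>Schwarz--Pick on the bidisc\<close>

text \<open>The pseudo-hyperbolic distance of the unit disk.\<close>

definition phyp :: "complex \<Rightarrow> complex \<Rightarrow> real" where
  "phyp z w = cmod (Moebius_function 0 w z)"

lemma phyp_alt: "phyp z w = cmod (z - w) / cmod (1 - cnj w * z)"
  by (simp add: phyp_def Moebius_function_simple norm_divide)

lemma phyp_less_1: "cmod z < 1 \<Longrightarrow> cmod w < 1 \<Longrightarrow> phyp z w < 1"
  by (simp add: phyp_def Moebius_function_norm_lt_1)

lemma one_minus_cnj_mult_nonzero: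
  assumes "cmod z < 1" "cmod w < 1"
  shows "1 - cnj w * z \<noteq> 0"
proof
  assume "1 - cnj w * z = 0"
  then have "cmod (cnj w * z) = 1" by simp
  moreover have "cmod w * cmod z < 1"
    using assms by (metis norm_ge_zero mult_le_one mult_strict_mono' mult_1)
  ultimately show False by (simp add: norm_mult)
qed

lemma norm_diff_le_phyp:
  assumes "cmod z < 1" "cmod w < 1"
  shows "cmod (z - w) \<le> 2 * phyp z w"
proof -
  have "cmod (1 - cnj w * z) \<le> 1 + cmod w * cmod z"
    by (metis norm_triangle_ineq4 norm_one norm_mult complex_mod_cnj)
  also have "cmod w * cmod z \<le> 1"
    using assms by (simp add: mult_le_one)
  finally have "cmod (1 - cnj w * z) \<le> 2" by simp
  moreover have "0 < cmod (1 - cnj w * z)"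
    using one_minus_cnj_mult_nonzero[OF assms] by simp
  ultimately show ?thesis
    using mult_left_mono[of "cmod (1 - cnj w * z)" 2 "cmod (z - w)"]
    by (simp add: phyp_alt pos_le_divide_eq mult.commute)
qed

text \<open>An analytic disc through (u, v) and (u', v') reduces the claim to the Schwarz lemma in
  one variable. Holomorphy of \<open>F\<close> is therefore expressed along pairs of holomorphic
  self-maps of the disk.\<close>

lemma schwarz_pick_bidisc:
  fixes F :: "complex \<Rightarrow> complex \<Rightarrow> complex"
  assumes hol: "\<And>h k. h holomorphic_on ball 0 1 \<Longrightarrow> k holomorphic_on ball 0 1 \<Longrightarrow>
      h ` ball 0 1 \<subseteq> ball 0 1 \<Longrightarrow> k ` ball 0 1 \<subseteq> ball 0 1 \<Longrightarrow>
      (\<lambda>z. F (h z) (k z)) holomorphic_on ball 0 1"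
    and F: "\<And>z w. cmod z < 1 \<Longrightarrow> cmod w < 1 \<Longrightarrow> cmod (F z w) < 1"
    and u: "cmod u < 1" "cmod u' < 1" and v: "cmod v < 1" "cmod v' < 1"
    and r: "phyp u' u \<le> r" "phyp v' v \<le> r"
  shows "phyp (F u' v') (F u v) \<le> r"
proof -
  \<comment> \<open>A common parameter lets the discs in both coordinates reach their second point
    simultaneously.\<close>
  define s where "s = max (phyp u' u) (phyp v' v)"
  have s: "s < 1" "phyp u' u \<le> s" "phyp v' v \<le> s" "s \<le> r" "0 \<le> s"
    using phyp_less_1 u v r by (auto simp: s_def phyp_def le_max_iff_disj)
  \<comment> \<open>\<open>disc p q\<close> sends 0 to p and s to q. If s = 0, the quotient is 0 by
    convention and the two points coincide, so this remains true.\<close>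
  define disc where "disc p q z = Moebius_function 0 (- p) (z * (Moebius_function 0 p q / s))"
    for p q z :: complex
  have scaled: "cmod (z * (Moebius_function 0 p q / s)) < 1"
    if "cmod z < 1" "phyp q p \<le> s" for p q z
  proof -
    have "cmod (Moebius_function 0 p q / s) \<le> 1"
      using that(2) s by (auto simp: phyp_def norm_divide divide_le_eq_1)
    then have "cmod z * cmod (Moebius_function 0 p q / s) \<le> cmod z * 1"
      by (intro mult_left_mono) auto
    then show ?thesis
      using that(1) by (simp only: norm_mult)
  qed
  have disc1: "disc p q ` ball 0 1 \<subseteq> ball 0 1" if "cmod p < 1" "phyp q p \<le> s" for p q
    using that scaled[OF _ that(2)] by (auto simp: disc_def Moebius_function_norm_lt_1)
  have disc_hol: "disc p q holomorphic_on ball 0 1" if "cmod p < 1" "phyp q p \<le> s" for p q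
  proof -
    have "Moebius_function 0 (- p) \<circ> (\<lambda>z. z * (Moebius_function 0 p q / s)) holomorphic_on ball 0 1"
    proof (rule holomorphic_on_compose_gen)
      show "(\<lambda>z. z * (Moebius_function 0 p q / s)) holomorphic_on ball 0 1"
        by (intro holomorphic_intros)
      show "Moebius_function 0 (- p) holomorphic_on ball 0 1"
        using that by (simp add: Moebius_function_holomorphic)
      show "(\<lambda>z. z * (Moebius_function 0 p q / s)) ` ball 0 1 \<subseteq> ball 0 1"
        using scaled[OF _ that(2)] by auto
    qed
    then show ?thesis
      by (simp add: disc_def [abs_def] comp_def)
  qed
  have disc_0: "disc p q 0 = p" for p q
    by (simp add: disc_def Moebius_function_simple)
  have disc_s: "disc p q s = q" if "cmod p < 1" "cmod q < 1" "phyp q p \<le> s" for p q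
  proof -
    have "s * (Moebius_function 0 p q / s) = Moebius_function 0 p q"
      using that(3) by (auto simp: phyp_def)
    then show ?thesis
      using Moebius_function_compose[of "- p" p q] that by (simp add: disc_def)
  qed
  define f where "f z = Moebius_function 0 (F u v) (F (disc u u' z) (disc v v' z))" for z
  have Fd: "cmod (F (disc u u' z) (disc v v' z)) < 1" if "cmod z < 1" for z
    using disc1[OF u(1) s(2)] disc1[OF v(1) s(3)] that by (intro F) (auto simp: image_subset_iff)
  have "Moebius_function 0 (F u v) \<circ> (\<lambda>z. F (disc u u' z) (disc v v' z)) holomorphic_on ball 0 1"
  proof (rule holomorphic_on_compose_gen)
    show "(\<lambda>z. F (disc u u' z) (disc v v' z)) holomorphic_on ball 0 1"
      by (intro hol disc_hol disc1 u v s)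
    show "Moebius_function 0 (F u v) holomorphic_on ball 0 1"
      using F u v by (simp add: Moebius_function_holomorphic)
    show "(\<lambda>z. F (disc u u' z) (disc v v' z)) ` ball 0 1 \<subseteq> ball 0 1"
      using Fd by auto
  qed
  then have "f holomorphic_on ball 0 1"
    by (simp add: f_def [abs_def] comp_def)
  moreover have "f 0 = 0"
    by (simp add: f_def disc_0 Moebius_function_eq_zero)
  moreover have "cmod (f z) < 1" if "cmod z < 1" for z
    using Fd[OF that] F u v by (simp add: f_def Moebius_function_norm_lt_1)
  ultimately have "cmod (f (of_real s)) \<le> cmod (of_real s)"
    using s by (intro Schwarz_Lemma(1)) auto
  moreover have "f (of_real s) = Moebius_function 0 (F u v) (F u' v')"
    using disc_s[OF u s(2)] disc_s[OF v s(3)] by (simp add: f_def)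
  ultimately show ?thesis
    using s by (simp add: phyp_def)
qed

text \<open>The pseudo-hyperbolic distance between \<theta> and -\<theta>, that is, the diameter of
  the disk of radius \<theta>.\<close>

definition shrink_factor :: "real \<Rightarrow> real" where
  "shrink_factor \<theta> = 2 * \<theta> / (1 + \<theta>\<^sup>2)"

lemma shrink_factor_bounds:
  assumes "0 < \<theta>" "\<theta> < 1"
  shows "0 < shrink_factor \<theta>" "shrink_factor \<theta> < 1"
proof -
  have "0 < 1 + \<theta>\<^sup>2" "0 < (1 - \<theta>)\<^sup>2"
    using assms by (auto intro: add_pos_nonneg)
  then show "0 < shrink_factor \<theta>" "shrink_factor \<theta> < 1"
    using assms by (auto simp: shrink_factor_def power2_eq_square algebra_simps)
qed

text \<open>On the disk |m| \<le> A the quotient |A - m| / |1 - m| is largest at m = -A.\<close>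

lemma norm_diff_shrink:
  fixes m :: complex
  assumes A: "0 < A" "A < 1" and m: "cmod m \<le> A"
  shows "cmod (A - m) * (1 + A) \<le> 2 * A * cmod (1 - m)"
proof (rule power2_le_imp_le)
  define x q where "x = Re m" and "q = (cmod m)\<^sup>2"
  have sq: "(cmod (of_real t - m))\<^sup>2 = t\<^sup>2 - 2 * t * x + q" for t
    unfolding x_def q_def cmod_power2 by (simp add: power2_eq_square algebra_simps)
  have "q \<le> A\<^sup>2"
    unfolding q_def using m by (simp add: power_mono)
  moreover have "4 * A\<^sup>2 \<le> (1 + A)\<^sup>2"
    using A power_mono[of "2 * A" "1 + A" 2] by (simp add: power_mult_distrib)
  ultimately have "0 \<le> ((1 + A)\<^sup>2 - 4 * A\<^sup>2) * (A\<^sup>2 - q)"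
    by simp
  moreover have "- A \<le> x"
    using m abs_Re_le_cmod[of m] by (simp add: x_def)
  then have "0 \<le> 2 * A * (1 - A)\<^sup>2 * (A + x)"
    using A by simp
  \<comment> \<open>The difference of the two squares is a sum of two products already known to be
    nonnegative.\<close>
  moreover have "4 * A\<^sup>2 * (1 - 2 * x + q) - (A\<^sup>2 - 2 * A * x + q) * (1 + A)\<^sup>2
      = 2 * A * (1 - A)\<^sup>2 * (A + x) + ((1 + A)\<^sup>2 - 4 * A\<^sup>2) * (A\<^sup>2 - q)"
    by (simp add: power2_eq_square algebra_simps)
  ultimately have "(A\<^sup>2 - 2 * A * x + q) * (1 + A)\<^sup>2 \<le> 4 * A\<^sup>2 * (1 - 2 * x + q)"
    by linarith
  then show "(cmod (A - m) * (1 + A))\<^sup>2 \<le> (2 * A * cmod (1 - m))\<^sup>2"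
    using sq[of A] sq[of 1] by (simp add: power_mult_distrib)
qed (use A in auto)

text \<open>With m = cnj w * z the two distances have quotient |\<theta>^2 - m| / (\<theta> |1 -
  m|), which \<open>norm_diff_shrink\<close> bounds for A = \<theta>^2.\<close>

lemma phyp_shrink:
  assumes \<theta>: "0 < \<theta>" "\<theta> < 1" and z: "cmod z < \<theta>" "cmod w < \<theta>"
  shows "phyp z w \<le> shrink_factor \<theta> * phyp (z / \<theta>) (w / \<theta>)"
proof -
  define m where "m = cnj w * z"
  have "cmod w * cmod z \<le> \<theta> * \<theta>"
    using z \<theta> by (intro mult_mono) auto
  then have m: "cmod m \<le> \<theta>\<^sup>2"
    by (simp add: m_def norm_mult power2_eq_square)
  have \<theta>2: "0 < \<theta>\<^sup>2" "\<theta>\<^sup>2 < 1"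
    using \<theta> by (auto simp: power_less_one_iff)
  have key: "cmod (of_real (\<theta>\<^sup>2) - m) * (1 + \<theta>\<^sup>2) \<le> 2 * \<theta>\<^sup>2 * cmod (1 - m)"
    by (rule norm_diff_shrink[OF \<theta>2 m])
  have n1: "0 < cmod (1 - m)"
    using one_minus_cnj_mult_nonzero[of z w] z \<theta> by (simp add: m_def)
  have "1 - cnj (w / \<theta>) * (z / \<theta>) \<noteq> 0"
    using z \<theta> by (intro one_minus_cnj_mult_nonzero) (auto simp: norm_divide)
  moreover have e: "1 - cnj (w / \<theta>) * (z / \<theta>) = (of_real (\<theta>\<^sup>2) - m) / of_real (\<theta>\<^sup>2)"
    using \<theta> by (simp add: m_def field_simps power2_eq_square)
  ultimately have n2: "0 < cmod (of_real (\<theta>\<^sup>2) - m)"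
    by auto
  have "phyp (z / \<theta>) (w / \<theta>) = (cmod (z - w) / \<theta>) / (cmod (of_real (\<theta>\<^sup>2) - m) / \<theta>\<^sup>2)"
    unfolding phyp_alt e using \<theta>
    by (simp add: norm_divide norm_power flip: diff_divide_distrib)
  also have "\<dots> = cmod (z - w) * (\<theta> / cmod (of_real (\<theta>\<^sup>2) - m))"
    using \<theta> by (simp add: power2_eq_square)
  finally have rhs: "shrink_factor \<theta> * phyp (z / \<theta>) (w / \<theta>)
      = cmod (z - w) * (2 * \<theta>\<^sup>2 / ((1 + \<theta>\<^sup>2) * cmod (of_real (\<theta>\<^sup>2) - m)))"
    by (simp add: shrink_factor_def power2_eq_square)
  have "1 / cmod (1 - m) \<le> 2 * \<theta>\<^sup>2 / ((1 + \<theta>\<^sup>2) * cmod (of_real (\<theta>\<^sup>2) - m))"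
  proof -
    have "0 < (1 + \<theta>\<^sup>2) * cmod (of_real (\<theta>\<^sup>2) - m)"
      using n2 \<theta>2 by (intro mult_pos_pos add_pos_pos) auto
    then show ?thesis
      using key n1 by (simp add: divide_le_eq pos_le_divide_eq mult.commute)
  qed
  then show ?thesis
    unfolding rhs by (simp add: phyp_alt m_def divide_inverse mult_left_mono)
qed

section \<open>The inverse branches\<close>

text \<open>In the coordinates \<open>x = R u\<close>, an orbit with symbols \<open>s\<^sub>n\<close> satisfies
  \<open>u\<^sub>n = branch \<dots> s\<^sub>n u\<^sub>n\<^sub>+\<^sub>1 u\<^sub>n\<^sub>-\<^sub>1\<close>.\<close>

definition branch :: "complex \<Rightarrow> complex \<Rightarrow> real \<Rightarrow> bool \<Rightarrow> complex \<Rightarrow> complex \<Rightarrow> complex" where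
  "branch a b R s u v = (if s then 1 else - 1) * csqrt (R * u + b * (R * v) - a) / R"

text \<open>For a = -\<alpha> the argument of the square root in \<open>branch\<close> stays in the
  right half-plane, where \<open>csqrt\<close> is holomorphic.\<close>

locale escape =
  fixes a b :: complex and \<alpha> R :: real
  assumes a: "a = - of_real \<alpha>" and R: "0 < R" "(1 + cmod b) * R < \<alpha>" "\<alpha> + (1 + cmod b) * R < R\<^sup>2"
begin

text \<open>The midpoint between 1 and the bound for the values of \<open>branch\<close>, hence
  strictly between them.\<close>

definition \<theta> :: real where
  "\<theta> = (1 + sqrt (\<alpha> + (1 + cmod b) * R) / R) / 2"

lemma bR: "0 < (1 + cmod b) * R"
  using R(1) by (simp add: add_pos_nonneg)

lemma theta: "0 < \<theta>" "\<theta> < 1" "sqrt (\<alpha> + (1 + cmod b) * R) / R < \<theta>"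
proof -
  have "sqrt (\<alpha> + (1 + cmod b) * R) < R"
    using R by (intro real_less_lsqrt) auto
  then have "sqrt (\<alpha> + (1 + cmod b) * R) / R < 1"
    using R(1) by simp
  moreover have "0 \<le> sqrt (\<alpha> + (1 + cmod b) * R) / R"
    using R bR by simp
  ultimately show "0 < \<theta>" "\<theta> < 1" "sqrt (\<alpha> + (1 + cmod b) * R) / R < \<theta>"
    by (auto simp: \<theta>_def field_simps)
qed

lemma branch_arg:
  fixes u v :: complex
  assumes "cmod u < 1" "cmod v < 1"
  shows "cmod (R * u + b * (R * v)) < \<alpha>"
    "cmod (R * u + b * (R * v) - a) < \<alpha> + (1 + cmod b) * R"
    "0 < Re (R * u + b * (R * v) - a)"
proof -
  have "cmod (R * u + b * (R * v)) \<le> cmod (R * u) + cmod (b * (R * v))"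
    by (rule norm_triangle_ineq)
  also have "\<dots> = R * cmod u + cmod b * (R * cmod v)"
    using R(1) by (simp add: norm_mult)
  also have "\<dots> < R * 1 + cmod b * (R * 1)"
    using assms R(1) by (intro add_less_le_mono mult_strict_left_mono mult_left_mono) auto
  finally have 1: "cmod (R * u + b * (R * v)) < (1 + cmod b) * R"
    by (simp add: algebra_simps)
  then show 2: "cmod (R * u + b * (R * v)) < \<alpha>"
    using R(2) by simp
  have "\<alpha> > 0" using R(2) bR by simp
  then have "cmod (R * u + b * (R * v) - a) \<le> cmod (R * u + b * (R * v)) + \<alpha>"
    using norm_triangle_ineq4[of "R * u + b * (R * v)" a] by (simp add: a)
  with 1 show "cmod (R * u + b * (R * v) - a) < \<alpha> + (1 + cmod b) * R" by simp
  show "0 < Re (R * u + b * (R * v) - a)"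
    using 2 abs_Re_le_cmod[of "R * u + b * (R * v)"] unfolding a by (simp add: abs_le_iff)
qed

lemma branch_norm:
  assumes "cmod u < 1" "cmod v < 1"
  shows "cmod (branch a b R s u v) < \<theta>"
proof -
  have "cmod (branch a b R s u v) = sqrt (cmod (R * u + b * (R * v) - a)) / R"
    using R(1) by (simp add: branch_def norm_mult norm_divide)
  also have "\<dots> < sqrt (\<alpha> + (1 + cmod b) * R) / R"
    using branch_arg(2)[OF assms] R(1) by (simp add: divide_strict_right_mono)
  also have "\<dots> < \<theta>"
    by (rule theta)
  finally show ?thesis .
qed

text \<open>Even after division by \<theta> the branch takes values in the unit disk, so
  Schwarz-Pick applies to the quotient; undoing the division gains the factor.\<close>

lemma branch_contract:
  assumes "cmod u < 1" "cmod u' < 1" "cmod v < 1" "cmod v' < 1"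
    and "phyp u' u \<le> r" "phyp v' v \<le> r"
  shows "phyp (branch a b R s u' v') (branch a b R s u v) \<le> shrink_factor \<theta> * r"
proof -
  have "phyp (branch a b R s u' v' / \<theta>) (branch a b R s u v / \<theta>) \<le> r"
  proof (rule schwarz_pick_bidisc[where F = "\<lambda>u v. branch a b R s u v / \<theta>", OF _ _ assms])
    fix h k :: "complex \<Rightarrow> complex"
    assume hk: "h holomorphic_on ball 0 1" "k holomorphic_on ball 0 1"
      and "h ` ball 0 1 \<subseteq> ball 0 1" "k ` ball 0 1 \<subseteq> ball 0 1"
    then have "cmod (h z) < 1" "cmod (k z) < 1" if "cmod z < 1" for z
      using that by (auto simp: image_subset_iff)
    then have "R * h z + b * (R * k z) - a \<notin> \<real>\<^sub>\<le>\<^sub>0" if "cmod z < 1" for z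
      using branch_arg(3)[of "h z" "k z"] that by (auto simp: complex_nonpos_Reals_iff)
    then show "(\<lambda>z. branch a b R s (h z) (k z) / \<theta>) holomorphic_on ball 0 1"
      unfolding branch_def using hk R(1) theta(1)
      by (intro holomorphic_intros) auto
  next
    show "cmod (branch a b R s z w / \<theta>) < 1" if "cmod z < 1" "cmod w < 1" for z w
      using branch_norm[OF that] theta(1) by (simp add: norm_divide)
  qed
  then have "shrink_factor \<theta> * phyp (branch a b R s u' v' / \<theta>) (branch a b R s u v / \<theta>)
      \<le> shrink_factor \<theta> * r"
    using shrink_factor_bounds(1)[OF theta(1,2)] by simp
  with phyp_shrink[OF theta(1,2) branch_norm[OF assms(2,4)] branch_norm[OF assms(1,3)]]
  show ?thesis
    by (rule order_trans)
qed

text \<open>All distances are below 1, uniformly in n, so k applications of the contraction bound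
  them by the k-th power of the factor.\<close>

lemma branch_fixed_unique:
  fixes u v :: "int \<Rightarrow> complex"
  assumes u: "\<And>n. cmod (u n) < 1" "\<And>n. u n = branch a b R (s n) (u (n + 1)) (u (n - 1))"
    and v: "\<And>n. cmod (v n) < 1" "\<And>n. v n = branch a b R (s n) (v (n + 1)) (v (n - 1))"
  shows "u n = v n"
proof -
  let ?C = "shrink_factor \<theta>"
  have le: "phyp (u n) (v n) \<le> ?C ^ k" for k n
  proof (induction k arbitrary: n)
    case 0
    show ?case
      using phyp_less_1[OF u(1) v(1)] by (simp add: less_imp_le)
  next
    case (Suc k)
    have "phyp (branch a b R (s n) (u (n + 1)) (u (n - 1)))
        (branch a b R (s n) (v (n + 1)) (v (n - 1))) \<le> ?C * ?C ^ k"
      by (intro branch_contract u v Suc)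
    then show ?case
      using u(2)[of n] v(2)[of n] by simp
  qed
  have "(\<lambda>k. ?C ^ k) \<longlonglongrightarrow> 0"
    using shrink_factor_bounds[OF theta(1,2)] by (intro LIMSEQ_power_zero) simp
  then have "phyp (u n) (v n) \<le> 0"
    using le by (intro LIMSEQ_le_const) auto
  with norm_diff_le_phyp[OF u(1) v(1), of n n] have "cmod (u n - v n) \<le> 0"
    by linarith
  then show ?thesis by simp
qed

text \<open>Picard iteration from the zero sequence converges at each index by comparison with a
  geometric series.\<close>

lemma branch_fixed_exists:
  obtains u :: "int \<Rightarrow> complex" where "\<And>n. cmod (u n) < 1"
    "\<And>n. u n = branch a b R (s n) (u (n + 1)) (u (n - 1))"
proof -
  let ?C = "shrink_factor \<theta>"
  have C: "0 < ?C" "?C < 1"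
    using shrink_factor_bounds[OF theta(1,2)] by auto
  define Y where "Y k = rec_nat (\<lambda>n::int. 0) (\<lambda>k y n. branch a b R (s n) (y (n + 1)) (y (n - 1))) k" for k
  have Y0: "Y 0 = (\<lambda>n. 0)" and
    YS: "Y (Suc k) n = branch a b R (s n) (Y k (n + 1)) (Y k (n - 1))" for k n
    by (simp_all add: Y_def)
  have Y\<theta>: "cmod (Y k n) < \<theta>" for k n
  proof (induction k arbitrary: n)
    case 0
    then show ?case using theta by (simp add: Y0)
  next
    case (Suc k)
    then show ?case
      unfolding YS using theta(2) by (intro branch_norm) (auto intro: less_trans)
  qed
  then have Y1: "cmod (Y k n) < 1" for k n
    using theta(2) less_trans by blast
  have step: "phyp (Y (Suc k) n) (Y k n) \<le> ?C ^ k" for k n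
  proof (induction k arbitrary: n)
    case 0
    show ?case
      using phyp_less_1[OF Y1 Y1] by (simp add: less_imp_le)
  next
    case (Suc k)
    have "phyp (branch a b R (s n) (Y (Suc k) (n + 1)) (Y (Suc k) (n - 1)))
        (branch a b R (s n) (Y k (n + 1)) (Y k (n - 1))) \<le> ?C * ?C ^ k"
      by (intro branch_contract Y1 Suc)
    then show ?case
      by (simp add: YS)
  qed
  have "convergent (\<lambda>k. Y k n)" for n
  proof -
    have le: "cmod (Y (Suc k) n - Y k n) \<le> 2 * ?C ^ k" for k
      using norm_diff_le_phyp[OF Y1 Y1, of "Suc k" n k n] step[of k n] by simp
    have "summable (\<lambda>k. 2 * ?C ^ k)"
      using C by (intro summable_mult summable_geometric) simp
    then have "summable (\<lambda>k. Y (Suc k) n - Y k n)"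
      by (rule summable_comparison_test'[where N = 0]) (rule le)
    then have "(\<lambda>m. \<Sum>k<m. Y (Suc k) n - Y k n) \<longlonglongrightarrow> (\<Sum>k. Y (Suc k) n - Y k n)"
      by (rule summable_LIMSEQ)
    then have "(\<lambda>m. Y m n) \<longlonglongrightarrow> (\<Sum>k. Y (Suc k) n - Y k n)"
      using sum_lessThan_telescope[of "\<lambda>k. Y k n"] by (simp add: Y0)
    then show ?thesis
      by (auto simp: convergent_def)
  qed
  then obtain u where u: "\<And>n. (\<lambda>k. Y k n) \<longlonglongrightarrow> u n"
    unfolding convergent_def by metis
  have "cmod (u n) \<le> \<theta>" for n
    using Y\<theta> by (intro LIMSEQ_le_const2[OF tendsto_norm[OF u]]) (auto intro: less_imp_le)
  then have u1: "cmod (u n) < 1" for n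
    using theta(2) le_less_trans by blast
  have "u n = branch a b R (s n) (u (n + 1)) (u (n - 1))" for n
  proof -
    have "R * u (n + 1) + b * (R * u (n - 1)) - a \<notin> \<real>\<^sub>\<le>\<^sub>0"
      using branch_arg(3)[OF u1 u1, of "n + 1" "n - 1"] by (auto simp: complex_nonpos_Reals_iff)
    then have "(\<lambda>k. csqrt (R * Y k (n + 1) + b * (R * Y k (n - 1)) - a))
        \<longlonglongrightarrow> csqrt (R * u (n + 1) + b * (R * u (n - 1)) - a)"
      by (intro isCont_tendsto_compose[where g = csqrt] continuous_at_csqrt tendsto_intros u)
    then have "(\<lambda>k. Y (Suc k) n) \<longlonglongrightarrow> branch a b R (s n) (u (n + 1)) (u (n - 1))"
      unfolding YS branch_def using R(1) by (intro tendsto_intros) auto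
    then show ?thesis
      using LIMSEQ_unique LIMSEQ_Suc[OF u] by blast
  qed
  with u1 that show ?thesis by blast
qed

end

section \<open>The coding is a conjugacy\<close>

lemma Hausdorff_sigma2: "Hausdorff_space (euclidean :: sigma2 topology)"
  unfolding Hausdorff_space_def
proof (intro allI impI)
  fix f g :: sigma2 assume "f \<in> topspace euclidean \<and> g \<in> topspace euclidean \<and> f \<noteq> g"
  then obtain i where i: "f i \<noteq> g i" by auto
  have "open ((\<lambda>h::sigma2. h i) -` {f i})" "open ((\<lambda>h::sigma2. h i) -` {g i})"
    by (auto intro!: open_vimage continuous_on_product_then_coordinatewise[OF continuous_on_id] open_discrete)
  with i show "\<exists>U V. openin euclidean U \<and> openin euclidean V \<and> f \<in> U \<and> g \<in> V \<and> disjnt U V"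
    by (intro exI[of _ "(\<lambda>h. h i) -` {f i}"] exI[of _ "(\<lambda>h. h i) -` {g i}"]) (auto simp: disjnt_def)
qed

lemma xcoord_norm_less:
  assumes "snd c \<noteq> 0" "p \<in> K c" "0 < R" "cmod (fst c) + (1 + cmod (snd c)) * R < R\<^sup>2"
  shows "cmod (xcoord c p n) < R"
  using bounded_orbit_bound[where x = "xcoord c p", OF _ xcoord_rec[OF assms(1)] assms(3,4)]
    assms(2) mem_K_iff[OF assms(1)] by simp

lemma xcoord_inj:
  assumes "snd c \<noteq> 0" "\<And>n. xcoord c p n = xcoord c q n"
  shows "p = q"
  using iter_henon_eq[OF assms(1), of 0 p] iter_henon_eq[OF assms(1), of 0 q] assms(2) by simp

text \<open>The escape radius is the same for all points and times, so closed conditions on the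
  x-coordinates cut out \<open>K c\<close>.\<close>

lemma compact_K:
  assumes "c \<in> HOV"
  shows "compact (K c)"
proof -
  have b: "snd c \<noteq> 0" and a: "2 * (1 + cmod (snd c))\<^sup>2 < cmod (fst c)"
    using assms(1) by (auto simp: HOV_def algebra_simps)
  obtain R where R: "0 < R" "cmod (fst c) + (1 + cmod (snd c)) * R < R\<^sup>2"
    using escape_radius[of "1 + cmod (snd c)" "cmod (fst c)"] a by auto
  have eq: "K c = (\<Inter>n. {p. cmod (xcoord c p n) \<le> R})"
  proof (intro Set.set_eqI iffI)
    fix p assume "p \<in> K c"
    then show "p \<in> (\<Inter>n. {p. cmod (xcoord c p n) \<le> R})"
      using xcoord_norm_less[OF b _ R] by (auto simp: less_imp_le)
  next
    fix p assume "p \<in> (\<Inter>n. {p. cmod (xcoord c p n) \<le> R})"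
    then show "p \<in> K c"
      by (auto simp: mem_K_iff[OF b] bounded_iff)
  qed
  have "closed (K c)"
    unfolding eq by (intro closed_INT ballI closed_Collect_le continuous_intros continuous_on_xcoord[OF b])
  moreover have "K c \<subseteq> cball 0 R \<times> cball 0 R"
  proof
    fix p assume "p \<in> K c"
    then have "cmod (xcoord c p 0) \<le> R" "cmod (xcoord c p (- 1)) \<le> R"
      by (auto simp: eq)
    then show "p \<in> cball 0 R \<times> cball 0 R"
      using iter_henon_eq[OF b, of 0 p] by (cases p) auto
  qed
  then have "bounded (K c)"
    by (rule bounded_subset[OF bounded_Times[OF bounded_cball bounded_cball]])
  ultimately show ?thesis
    by (simp add: compact_eq_bounded_closed)
qed

text \<open>The square has positive real part, which is (Re z)^2 - (Im z)^2.\<close>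

lemma Im_less_Re:
  assumes "a = - of_real \<alpha>" "cmod (z\<^sup>2 + a) < \<alpha>"
  shows "\<bar>Im z\<bar> < \<bar>Re z\<bar>"
proof -
  have "\<bar>Re (z\<^sup>2) - \<alpha>\<bar> < \<alpha>"
    using abs_Re_le_cmod[of "z\<^sup>2 + a"] assms by simp
  then have "0 < Re (z\<^sup>2)" by linarith
  then have "(Im z)\<^sup>2 < (Re z)\<^sup>2"
    by (simp add: power2_eq_square)
  then show ?thesis
    by (simp add: abs_le_square_iff flip: not_le)
qed

locale real_HOV =
  fixes c :: "complex \<times> complex"
  assumes HOV: "c \<in> HOV" and real: "fst c \<in> \<real>" and neg: "Re (fst c) < 0"
begin

lemma snd_nonzero [simp]: "snd c \<noteq> 0"
  using HOV by (auto simp: HOV_def)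

lemma fst_eq: "fst c = - of_real (cmod (fst c))"
  using real neg by (metis Re_complex_of_real Reals_cases abs_of_neg minus_minus norm_of_real of_real_minus)

text \<open>So the sign of the real part tells the two square roots apart. This serves in place of
  the reality of the points of \<open>K c\<close>.\<close>

lemma xcoord_Im_less_Re: "p \<in> K c \<Longrightarrow> \<bar>Im (xcoord c p n)\<bar> < \<bar>Re (xcoord c p n)\<bar>"
  using Im_less_Re[OF fst_eq] K_square_bound[OF HOV] by blast

lemma escape_ex:
  obtains R where "escape (fst c) (snd c) (cmod (fst c)) R"
proof -
  have a: "2 * (1 + cmod (snd c))\<^sup>2 < cmod (fst c)"
    using HOV by (auto simp: HOV_def algebra_simps)
  obtain R where "0 < R" "(1 + cmod (snd c)) * R < cmod (fst c)"
    "cmod (fst c) + (1 + cmod (snd c)) * R < R\<^sup>2"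
    using escape_radius[of "1 + cmod (snd c)" "cmod (fst c)"] a by auto
  with fst_eq that show ?thesis
    by (simp add: escape_def)
qed

text \<open>The rescaled x-coordinates form a fixed sequence of the branches that the symbols
  select, and such a sequence is unique.\<close>

lemma inj_on_coding: "inj_on (coding c) (K c)"
proof (rule inj_onI)
  obtain R where "escape (fst c) (snd c) (cmod (fst c)) R"
    by (rule escape_ex)
  then interpret escape "fst c" "snd c" "cmod (fst c)" R .
  fix p q assume pq: "p \<in> K c" "q \<in> K c" and eq: "coding c p = coding c q"
  have u1: "cmod (xcoord c p n / R) < 1" if "p \<in> K c" for p n
    using xcoord_norm_less[OF snd_nonzero that R(1,3)] R(1) by (simp add: norm_divide)
  have fixed: "xcoord c p n / R = branch (fst c) (snd c) R (coding c p n)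
      (xcoord c p (n + 1) / R) (xcoord c p (n - 1) / R)" if "p \<in> K c" for p n
  proof -
    have "R * (xcoord c p (n + 1) / R) + snd c * (R * (xcoord c p (n - 1) / R)) - fst c
        = (xcoord c p n)\<^sup>2"
      using xcoord_rec[OF snd_nonzero, of p n] R(1) by simp
    moreover have "csqrt ((xcoord c p n)\<^sup>2)
        = (if coding c p n then 1 else - 1) * xcoord c p n"
    proof (cases "0 < Re (xcoord c p n)")
      case True
      then show ?thesis
        using csqrt_square[of "xcoord c p n"] by (simp add: coding_eq)
    next
      case False
      then have "0 < Re (- xcoord c p n)"
        using xcoord_Im_less_Re[OF that, of n] by (simp add: abs_if split: if_splits)
      then have "csqrt ((xcoord c p n)\<^sup>2) = - xcoord c p n"
        by (intro csqrt_unique) auto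
      with False show ?thesis
        by (simp add: coding_eq)
    qed
    ultimately show ?thesis
      by (simp add: branch_def)
  qed
  have "xcoord c p n / R = xcoord c q n / R" for n
    by (rule branch_fixed_unique[where s = "coding c p", OF u1[OF pq(1)] fixed[OF pq(1)]
          u1[OF pq(2)] fixed[OF pq(2), folded eq]])
  then show "p = q"
    using R(1) by (intro xcoord_inj) auto
qed

text \<open>The fixed sequence of the branches selected by s, scaled by R, is a bounded orbit. The
  principal root has positive real part, so the symbols come out as s.\<close>

lemma surj_on_coding: "coding c ` K c = UNIV"
proof (intro equalityI subsetI UNIV_I)
  obtain R where "escape (fst c) (snd c) (cmod (fst c)) R"
    by (rule escape_ex)
  then interpret escape "fst c" "snd c" "cmod (fst c)" R .
  fix s :: sigma2
  obtain u where u: "\<And>n. cmod (u n) < 1"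
    "\<And>n. u n = branch (fst c) (snd c) R (s n) (u (n + 1)) (u (n - 1))"
    using branch_fixed_exists by blast
  define x where "x n = R * u n" for n
  define w where "w n = R * u (n + 1) + snd c * (R * u (n - 1)) - fst c" for n
  have x: "x n = (if s n then 1 else - 1) * csqrt (w n)" for n
    unfolding x_def w_def by (subst u(2)) (use R(1) in \<open>simp add: branch_def\<close>)
  have "(x n)\<^sup>2 = w n" for n
    by (simp add: x power_mult_distrib)
  then have "x (n + 1) = (x n)\<^sup>2 + fst c - snd c * x (n - 1)" for n
    by (simp add: x_def w_def)
  then have xc: "xcoord c (x 0, x (- 1)) n = x n" for n
    by (rule xcoord_eqI[OF snd_nonzero])
  have "cmod (x n) \<le> R" for n
    using u(1)[of n] R(1) by (simp add: x_def norm_mult mult_left_le)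
  then have "(x 0, x (- 1)) \<in> K c"
    by (auto simp: mem_K_iff[OF snd_nonzero] xc bounded_iff)
  moreover have "coding c (x 0, x (- 1)) = s"
  proof
    fix n
    have "0 < Re (w n)"
      unfolding w_def by (rule branch_arg(3)[OF u(1) u(1)])
    then have "0 < Re (csqrt (w n))"
      by (simp add: add_nonneg_pos)
    then show "coding c (x 0, x (- 1)) n = s n"
      using x[of n] by (simp add: coding_eq xc)
  qed
  ultimately show "s \<in> coding c ` K c"
    by blast
qed

lemma continuous_on_coding: "continuous_on (K c) (coding c)"
proof (rule continuous_on_coordinatewise_then_product)
  fix n
  have nz: "Re (xcoord c p n) \<noteq> 0" if "p \<in> K c" for p
    using xcoord_Im_less_Re[OF that, of n] by auto
  show "continuous_on (K c) (\<lambda>p. coding c p n)"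
    unfolding continuous_on_open_invariant
  proof (intro allI impI)
    fix B :: "bool set"
    \<comment> \<open>As the real part does not vanish on \<open>K c\<close>, the symbol 0 is an
      open condition too.\<close>
    define A where "A = (if True \<in> B then {p. 0 < Re (xcoord c p n)} else {}) \<union>
      (if False \<in> B then {p. Re (xcoord c p n) < 0} else {})"
    have "open A"
      unfolding A_def
      by (auto intro!: open_Un open_Collect_less continuous_intros continuous_on_xcoord)
    moreover have "A \<inter> K c = (\<lambda>p. coding c p n) -` B \<inter> K c"
    proof (intro Set.set_eqI)
      fix p
      have "p \<in> A \<longleftrightarrow> coding c p n \<in> B" if "p \<in> K c"
        using nz[OF that] by (cases "0 < Re (xcoord c p n)") (auto simp: A_def coding_eq)
      then show "p \<in> A \<inter> K c \<longleftrightarrow> p \<in> (\<lambda>p. coding c p n) -` B \<inter> K c" by auto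
    qed
    ultimately show "\<exists>A. open A \<and> A \<inter> K c = (\<lambda>p. coding c p n) -` B \<inter> K c"
      by blast
  qed
qed

text \<open>A continuous bijection from a compact space onto a Hausdorff space is a
  homeomorphism.\<close>

lemma conjugacy_coding: "conjugacy (K c) (henon c) UNIV shift (coding c)"
proof -
  have "homeomorphic_map (top_of_set (K c)) euclidean (coding c)"
    using compact_K[OF HOV] continuous_on_coding surj_on_coding inj_on_coding
    by (intro continuous_imp_homeomorphic_map Hausdorff_sigma2)
      (auto simp: compact_space_subtopology)
  then obtain k where "homeomorphic_maps (top_of_set (K c)) euclidean (coding c) k"
    using homeomorphic_map_maps by blast
  then have k: "continuous_on UNIV k" "\<And>y. k y \<in> K c" "\<And>x. x \<in> K c \<Longrightarrow> k (coding c x) = x"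
      "\<And>y. coding c (k y) = y"
    by (auto simp: homeomorphic_maps_def continuous_map_in_subtopology)
  then have "homeomorphism (K c) UNIV (coding c) k"
    unfolding homeomorphism_def using continuous_on_coding surj_on_coding
    by (auto simp del: split_paired_All) (metis image_eqI k(3) UNIV_I)
  then show ?thesis
    using coding_henon[OF snd_nonzero] by (auto simp: conjugacy_def)
qed

end

section \<open>Automorphisms and monodromies\<close>

lemma carrier_Aut:
  "\<phi> \<in> carrier Aut_sigma2 \<longleftrightarrow>
    (\<exists>\<psi>. continuous_on UNIV \<phi> \<and> continuous_on UNIV \<psi> \<and> (\<forall>s. \<psi> (\<phi> s) = s) \<and> (\<forall>s. \<phi> (\<psi> s) = s)) \<and>
    (\<forall>s. \<phi> (shift s) = shift (\<phi> s))"
proof -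
  have "homeomorphism UNIV UNIV \<phi> \<psi> \<longleftrightarrow>
      continuous_on UNIV \<phi> \<and> continuous_on UNIV \<psi> \<and> (\<forall>s. \<psi> (\<phi> s) = s) \<and> (\<forall>s. \<phi> (\<psi> s) = s)"
    for \<psi>
    unfolding homeomorphism_def by (metis UNIV_I surjI)
  then have "(\<exists>\<psi>. homeomorphism UNIV UNIV \<phi> \<psi>) \<longleftrightarrow> (\<exists>\<psi>. continuous_on UNIV \<phi> \<and>
      continuous_on UNIV \<psi> \<and> (\<forall>s. \<psi> (\<phi> s) = s) \<and> (\<forall>s. \<phi> (\<psi> s) = s))"
    by (rule ex_cong1)
  moreover have "\<phi> \<circ> shift = shift \<circ> \<phi> \<longleftrightarrow> (\<forall>s. \<phi> (shift s) = shift (\<phi> s))"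
    by (metis comp_apply ext)
  ultimately show ?thesis
    by (simp only: Aut_sigma2_def partial_object.simps mem_Collect_eq)
qed

lemma mult_Aut [simp]: "\<phi> \<otimes>\<^bsub>Aut_sigma2\<^esub> \<psi> = \<phi> \<circ> \<psi>"
  and one_Aut [simp]: "\<one>\<^bsub>Aut_sigma2\<^esub> = id"
  by (simp_all add: Aut_sigma2_def)

lemma group_Aut: "group Aut_sigma2"
proof (rule groupI)
  fix \<phi> \<phi>' assume *: "\<phi> \<in> carrier Aut_sigma2" "\<phi>' \<in> carrier Aut_sigma2"
  then obtain \<psi> \<psi>' where
    "continuous_on UNIV \<phi>" "continuous_on UNIV \<psi>" "\<And>s. \<psi> (\<phi> s) = s" "\<And>s. \<phi> (\<psi> s) = s"
    "continuous_on UNIV \<phi>'" "continuous_on UNIV \<psi>'" "\<And>s. \<psi>' (\<phi>' s) = s" "\<And>s. \<phi>' (\<psi>' s) = s"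
    by (auto simp: carrier_Aut)
  then have "continuous_on UNIV (\<phi> \<circ> \<phi>')" "continuous_on UNIV (\<psi>' \<circ> \<psi>)"
    "\<forall>s. (\<psi>' \<circ> \<psi>) ((\<phi> \<circ> \<phi>') s) = s" "\<forall>s. (\<phi> \<circ> \<phi>') ((\<psi>' \<circ> \<psi>) s) = s"
    by (simp_all add: comp_def continuous_on_compose2[where s = UNIV and t = UNIV])
  moreover have "(\<phi> \<circ> \<phi>') (shift s) = shift ((\<phi> \<circ> \<phi>') s)" for s
    using * by (simp add: carrier_Aut)
  ultimately show "\<phi> \<otimes>\<^bsub>Aut_sigma2\<^esub> \<phi>' \<in> carrier Aut_sigma2"
    unfolding mult_Aut carrier_Aut by blast
next
  show "\<one>\<^bsub>Aut_sigma2\<^esub> \<in> carrier Aut_sigma2"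
    unfolding carrier_Aut one_Aut by (intro conjI exI[of _ id]) (auto simp: continuous_on_id)
next
  fix \<phi> assume *: "\<phi> \<in> carrier Aut_sigma2"
  then obtain \<psi> where \<psi>:
    "continuous_on UNIV \<phi>" "continuous_on UNIV \<psi>" "\<And>s. \<psi> (\<phi> s) = s" "\<And>s. \<phi> (\<psi> s) = s"
    by (auto simp: carrier_Aut)
  have "\<psi> (shift s) = shift (\<psi> s)" for s
    using * \<psi>(3)[of "shift (\<psi> s)"] \<psi>(4) by (simp add: carrier_Aut)
  then have "\<psi> \<in> carrier Aut_sigma2"
    using \<psi> carrier_Aut by blast
  then show "\<exists>\<psi>\<in>carrier Aut_sigma2. \<psi> \<otimes>\<^bsub>Aut_sigma2\<^esub> \<phi> = \<one>\<^bsub>Aut_sigma2\<^esub>"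
    using \<psi>(3) by (intro bexI[of _ \<psi>]) auto
qed (auto simp: comp_assoc)

lemma continuous_on_shift_index: "continuous_on UNIV (\<lambda>s::sigma2. s n)"
  by (rule continuous_on_product_then_coordinatewise[OF continuous_on_id])

lemma shift_in_Aut: "shift \<in> carrier Aut_sigma2"
  unfolding carrier_Aut
proof (intro conjI exI[of _ "\<lambda>s n. s (n - 1)"])
  show "continuous_on UNIV shift"
    unfolding shift_def [abs_def]
    by (intro continuous_on_coordinatewise_then_product continuous_on_shift_index)
  show "continuous_on UNIV (\<lambda>s (n::int). s (n - 1) :: bool)"
    by (intro continuous_on_coordinatewise_then_product continuous_on_shift_index)
qed (auto simp: shift_def)

text \<open>Both -u^2/a and the conjugate of -v^2/a have positive real part, so their product is not
  a nonpositive real. It would be one if u * cnj v were imaginary, being the square of that number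
  over |a|^2.\<close>

lemma Re_mult_cnj_nonzero:
  assumes "cmod (u\<^sup>2 + a) < cmod a" "cmod (v\<^sup>2 + a) < cmod a"
  shows "Re (u * cnj v) \<noteq> 0"
proof
  assume 0: "Re (u * cnj v) = 0"
  have a: "a \<noteq> 0" using assms(1) by auto
  have pos: "0 < Re (- (z\<^sup>2) / a)" if "cmod (z\<^sup>2 + a) < cmod a" for z
  proof -
    have "1 - (- (z\<^sup>2) / a) = (z\<^sup>2 + a) / a"
      using a by (simp add: field_simps)
    then have "cmod (1 - (- (z\<^sup>2) / a)) < 1"
      using that a by (simp add: norm_divide)
    then show ?thesis
      using complex_Re_le_cmod[of "1 - (- (z\<^sup>2) / a)"] by simp
  qed
  define \<mu> \<nu> where "\<mu> = - (u\<^sup>2) / a" and "\<nu> = cnj (- (v\<^sup>2) / a)"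
  have \<mu>: "0 < Re \<mu>" and \<nu>: "0 < Re \<nu>"
    using pos[OF assms(1)] pos[OF assms(2)] by (simp_all only: \<mu>_def \<nu>_def cnj.sel)
  define y where "y = Im (u * cnj v)"
  have uv: "u * cnj v = \<i> * of_real y"
    using 0 by (simp add: y_def complex_eq_iff)
  have aa: "a * cnj a = of_real ((cmod a)\<^sup>2)"
    by (simp only: complex_norm_square)
  have "\<mu> * \<nu> = (u * cnj v)\<^sup>2 / (a * cnj a)"
    by (simp add: \<mu>_def \<nu>_def power_mult_distrib)
  also have "\<dots> = of_real (- (y\<^sup>2) / (cmod a)\<^sup>2)"
    unfolding uv aa by (simp add: power_mult_distrib)
  finally have e: "\<mu> * \<nu> = of_real (- (y\<^sup>2) / (cmod a)\<^sup>2)" .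
  define r where "r = y\<^sup>2 / (cmod a)\<^sup>2"
  have r: "0 \<le> r" "Re (\<mu> * \<nu>) = - r" "Im (\<mu> * \<nu>) = 0"
    unfolding e r_def by simp_all
  \<comment> \<open>Computes |\<mu>|^2 Re \<nu>, which is positive, while the left side is -r Re
    \<mu>.\<close>
  have "Re (\<mu> * \<nu>) * Re \<mu> = (Re \<mu> * Re \<mu> + Im \<mu> * Im \<mu>) * Re \<nu> - Im \<mu> * Im (\<mu> * \<nu>)"
    by (simp add: algebra_simps)
  also have "\<dots> > 0"
    using \<mu> \<nu> r(3) by (simp add: add_pos_nonneg)
  finally show False
    using r(1,2) \<mu> by (simp add: zero_less_mult_iff)
qed

lemma constant_sign:
  fixes f :: "real \<Rightarrow> real"
  assumes "continuous_on {0..1} f" "\<And>t. t \<in> {0..1} \<Longrightarrow> f t \<noteq> 0"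
  shows "0 < f 0 \<longleftrightarrow> 0 < f 1"
proof (rule ccontr)
  assume "\<not> ?thesis"
  then consider "f 0 \<le> 0" "0 \<le> f 1" | "f 1 \<le> 0" "0 \<le> f 0" by linarith
  then have "\<exists>t\<ge>0. t \<le> 1 \<and> f t = 0"
    using IVT'[of f 0 0 1] IVT2'[of f 1 0 0] assms(1) by cases auto
  with assms(2) show False by auto
qed

text \<open>Translates the quantity that keeps its sign along the path into agreement of symbols at
  the base point.\<close>

lemma Re_mult_cnj_pos_iff:
  assumes "\<bar>Im u\<bar> < \<bar>Re u\<bar>" "\<bar>Im v\<bar> < \<bar>Re v\<bar>"
  shows "0 < Re (u * cnj v) \<longleftrightarrow> (0 < Re u \<longleftrightarrow> 0 < Re v)"
proof -
  have "\<bar>Im u * Im v\<bar> < \<bar>Re u * Re v\<bar>"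
    unfolding abs_mult using assms by (intro mult_strict_mono') auto
  moreover have "Re (u * cnj v) = Re u * Re v + Im u * Im v"
    by simp
  ultimately have "0 < Re (u * cnj v) \<longleftrightarrow> 0 < Re u * Re v"
    by (simp add: abs_if split: if_splits)
  also have "\<dots> \<longleftrightarrow> (0 < Re u \<longleftrightarrow> 0 < Re v)"
    using assms by (auto simp: zero_less_mult_iff)
  finally show ?thesis .
qed

lemma conjugacy_in: "conjugacy X f Y g h \<Longrightarrow> p \<in> X \<Longrightarrow> h p \<in> Y"
  by (auto simp: conjugacy_def homeomorphism_def)

lemma continuous_on_family:
  assumes "conjugacy_family \<gamma> g" "p \<in> K (\<gamma> 0)"
  shows "continuous_on {0..1} (\<lambda>t. g t p)"
proof -
  have "continuous_on {0..1} (\<lambda>t. (\<lambda>(t, p). g t p) (t, p))"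
    using assms unfolding conjugacy_family_def
    by (intro continuous_on_compose2[where s = "{0..1}" and g = "\<lambda>(t, p). g t p"] continuous_intros) auto
  then show ?thesis by simp
qed

context real_HOV
begin

lemma self_conjugacy_in_Aut:
  assumes "conjugacy (K c) (henon c) (K c) (henon c) h"
  shows "coding c \<circ> h \<circ> inv_into (K c) (coding c) \<in> carrier Aut_sigma2"
proof -
  obtain k where k: "homeomorphism (K c) UNIV (coding c) k"
    using conjugacy_coding by (auto simp: conjugacy_def)
  obtain h' where h: "homeomorphism (K c) (K c) h h'"
    using assms by (auto simp: conjugacy_def)
  have inv: "inv_into (K c) (coding c) = k"
  proof
    fix s
    have "k s \<in> K c" "coding c (k s) = s"
      using k by (auto simp: homeomorphism_def)
    then show "inv_into (K c) (coding c) s = k s"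
      using inv_into_f_eq[OF inj_on_coding] by blast
  qed
  have "homeomorphism UNIV UNIV (coding c \<circ> h \<circ> k) (coding c \<circ> (h' \<circ> k))"
    using homeomorphism_compose[OF homeomorphism_compose[OF homeomorphism_symD[OF k] h] k]
    by (simp add: comp_assoc)
  moreover have "(coding c \<circ> h \<circ> k) (shift s) = shift ((coding c \<circ> h \<circ> k) s)" for s
  proof -
    have ks: "k s \<in> K c" "coding c (k s) = s"
      using k by (auto simp: homeomorphism_def)
    moreover from this have "k (coding c (henon c (k s))) = henon c (k s)"
      using k henon_in_K[OF snd_nonzero, of "k s"] unfolding homeomorphism_def by blast
    ultimately have "k (shift s) = henon c (k s)"
      using coding_henon[OF snd_nonzero, of "k s"] by simp
    then show ?thesis
      using assms ks(1) coding_henon[OF snd_nonzero] by (simp add: conjugacy_def)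
  qed
  ultimately show ?thesis
    unfolding inv by (auto simp: Aut_sigma2_def fun_eq_iff)
qed

lemma rho_pi1E:
  assumes "\<phi> \<in> rho_pi1 c U"
  obtains \<gamma> g where "path \<gamma>" "path_image \<gamma> \<subseteq> U" "\<gamma> 0 = c" "\<gamma> 1 = c" "conjugacy_family \<gamma> g"
    "conjugacy (K c) (henon c) (K c) (henon c) (g 1)" "\<And>p. p \<in> K c \<Longrightarrow> g 0 p = p"
    "\<And>p. p \<in> K c \<Longrightarrow> \<phi> (coding c p) = coding c (g 1 p)"
    "\<phi> = coding c \<circ> g 1 \<circ> inv_into (K c) (coding c)"
proof -
  from assms obtain \<gamma> g where *: "path \<gamma>" "path_image \<gamma> \<subseteq> U" "\<gamma> 0 = c" "\<gamma> 1 = c"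
    "conjugacy_family \<gamma> g" and \<phi>: "\<phi> = coding c \<circ> g 1 \<circ> inv_into (K c) (coding c)"
    by (auto simp: rho_pi1_def monodromy_def pathstart_def pathfinish_def)
  from *(5) have "\<forall>t\<in>{0..1}. conjugacy (K c) (henon c) (K (\<gamma> t)) (henon (\<gamma> t)) (g t)"
    and g0: "\<forall>p\<in>K c. g 0 p = p"
    unfolding conjugacy_family_def *(3) by blast+
  then have "conjugacy (K c) (henon c) (K c) (henon c) (g 1)"
    using *(4) by (metis atLeastAtMost_iff order_refl zero_le_one)
  moreover have "\<phi> (coding c p) = coding c (g 1 p)" if "p \<in> K c" for p
    using that inv_into_f_f[OF inj_on_coding] by (simp add: \<phi>)
  ultimately show ?thesis
    using that * g0 \<phi> by blast
qed

lemma rho_pi1_subset_Aut: "rho_pi1 c U \<subseteq> carrier Aut_sigma2"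
proof
  fix \<phi> assume "\<phi> \<in> rho_pi1 c U"
  then show "\<phi> \<in> carrier Aut_sigma2"
    by (rule rho_pi1E) (use self_conjugacy_in_Aut in simp)
qed

lemma coding_iter: "coding c p n = coding c (iter (henon c) n p) 0"
  using xcoord_iter[OF snd_nonzero] by (simp add: coding_eq)

text \<open>For two points of \<open>K\<close> the angle between their \<open>x\<close>-coordinates, taken as lines, stays below
  a right angle along a path in \<^term>\<open>HOV\<close>: both squares lie in the disk of radius \<open>|a|\<close> about
  \<open>-a\<close>. So whether their symbols agree is invariant.\<close>

lemma rho_pi1_HOV:
  assumes "\<phi> \<in> rho_pi1 c HOV"
  obtains d where "\<And>s n. \<phi> s n \<longleftrightarrow> s n \<noteq> d"
proof -
  obtain \<gamma> g where "path \<gamma>" and \<gamma>: "path_image \<gamma> \<subseteq> HOV" "\<gamma> 0 = c" "\<gamma> 1 = c" and fam: "conjugacy_family \<gamma> g"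
    and g1: "conjugacy (K c) (henon c) (K c) (henon c) (g 1)" and g0: "\<And>p. p \<in> K c \<Longrightarrow> g 0 p = p"
    and \<phi>: "\<And>p. p \<in> K c \<Longrightarrow> \<phi> (coding c p) = coding c (g 1 p)"
    and "\<phi> = coding c \<circ> g 1 \<circ> inv_into (K c) (coding c)"
    using assms by (rule rho_pi1E) (rule that; assumption)
  have x: "cmod ((fst (g t p))\<^sup>2 + fst (\<gamma> t)) < cmod (fst (\<gamma> t))" if "t \<in> {0..1}" "p \<in> K c" for t p
  proof -
    have "\<gamma> t \<in> HOV" using \<gamma>(1) that(1) by (auto simp: path_image_def)
    moreover have "g t p \<in> K (\<gamma> t)"
      using fam that conjugacy_in unfolding conjugacy_family_def \<gamma>(2) by blast
    ultimately show ?thesis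
      using K_square_bound[of "\<gamma> t" "g t p" 0] by (simp add: xcoord_def)
  qed
  have agree: "(coding c p 0 = coding c q 0) = (coding c (g 1 p) 0 = coding c (g 1 q) 0)"
    if pq: "p \<in> K c" "q \<in> K c" for p q
  proof -
    have "0 < Re (fst (g 0 p) * cnj (fst (g 0 q))) \<longleftrightarrow> 0 < Re (fst (g 1 p) * cnj (fst (g 1 q)))"
    proof (rule constant_sign)
      show "continuous_on {0..1} (\<lambda>t. Re (fst (g t p) * cnj (fst (g t q))))"
        using pq by (intro continuous_intros continuous_on_family[OF fam]) (simp_all add: \<gamma>(2))
      show "Re (fst (g t p) * cnj (fst (g t q))) \<noteq> 0" if "t \<in> {0..1}" for t
        by (rule Re_mult_cnj_nonzero[OF x[OF that pq(1)] x[OF that pq(2)]])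
    qed
    moreover have "0 < Re (fst p * cnj (fst q)) \<longleftrightarrow> (coding c p 0 = coding c q 0)"
      if "p \<in> K c" "q \<in> K c" for p q
      using Re_mult_cnj_pos_iff[OF xcoord_Im_less_Re[OF that(1), of 0] xcoord_Im_less_Re[OF that(2), of 0]]
      by (simp add: coding_eq xcoord_def)
    ultimately show ?thesis
      using pq g0 conjugacy_in[OF g1] by metis
  qed
  obtain q where q: "q \<in> K c"
    using surj_on_coding by blast
  \<comment> \<open>One reference point decides whether the symbols are exchanged; agreement with it
    settles every other point, and iteration every other index.\<close>
  define d where "d = (coding c (g 1 q) 0 \<noteq> coding c q 0)"
  have "\<phi> s n \<longleftrightarrow> s n \<noteq> d" for s n
  proof -
    obtain p where p: "p \<in> K c" "s = coding c p"
      using surj_on_coding by blast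
    let ?p = "iter (henon c) n p"
    have "\<phi> s n = coding c (g 1 ?p) 0"
      using \<phi> p conjugacy_iter[OF g1 snd_nonzero snd_nonzero p(1)] coding_iter by metis
    moreover have "s n = coding c ?p 0"
      using p coding_iter by metis
    ultimately show ?thesis
      using agree[OF iter_in_K[OF snd_nonzero p(1), of n] q] unfolding d_def by blast
  qed
  then show ?thesis by (rule that)
qed

end

section \<open>Itineraries along a path in \<open>W\<close>\<close>

lemma Wbase_Re: "a \<in> Wbase \<Longrightarrow> Re a < 0"
  using norm_ge_zero[of a] unfolding Wbase_def mem_Collect_eq by linarith

text \<open>As -a stays in the right half-plane, where \<open>Ln\<close> is continuous, the angle
  varies continuously with a.\<close>

lemma Arg2pi_Re_neg:
  assumes "Re a < 0"
  shows "0 < Arg2pi a" "Arg2pi a = Im (Ln (- a)) + pi"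
proof -
  show "0 < Arg2pi a"
    using Arg2pi_ge_0[of a] Arg2pi_eq_0[of a] assms by (force simp: less_le)
  then show "Arg2pi a = Im (Ln (- a)) + pi"
    by (rule Arg2pi_Ln)
qed

lemma continuous_on_height:
  assumes "continuous_on S A" "continuous_on S x" "\<And>s. s \<in> S \<Longrightarrow> Re (A s) < 0"
  shows "continuous_on S (\<lambda>s. height (A s) (x s))"
proof -
  have "continuous_on S (\<lambda>s. Im (cis (- ((Im (Ln (- A s)) + pi) / 2)) * x s))"
    using assms by (intro continuous_intros) (auto simp: complex_nonpos_Reals_iff dest!: assms(3))
  then show ?thesis
    using assms(3) by (subst continuous_on_cong[OF refl]) (auto simp: height_def Arg2pi_Re_neg)
qed

text \<open>The angle is pi here, so the pieces with index 0 and 2 are the right and the left half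
  of the punctured disk. This ties indices to symbols.\<close>

lemma height_real:
  assumes "a \<in> \<real>" "Re a < 0"
  shows "height a z = - Re z"
  using assms by (simp add: height_def Arg2pi_eq_pi[THEN iffD2] cis_minus_pi_half flip: cis_cnj)

text \<open>Off the line of height 0 one of the half-disks contains z. A point s e^(i phi/2) of the
  line is mapped to (s^2 + |a|) e^(i phi), whose height (s^2 + |a|) sin (phi/2) exceeds -t, so it
  lies in the piece with index 1.\<close>

lemma D_cover:
  assumes "Re a < 0" "0 < t" "cmod z < R"
  shows "z \<in> D a R t 0 \<union> D a R t 1 \<union> D a R t 2"
proof (cases "height a z = 0")
  case False
  then have "z \<noteq> 0" by (auto simp: height_def)
  with False assms(3) show ?thesis
    by (auto simp: D_def)
next
  case True
  define \<omega> where "\<omega> = cis (Arg2pi a / 2)"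
  define s where "s = Re (cis (- (Arg2pi a / 2)) * z)"
  have "cis (- (Arg2pi a / 2)) * z = of_real s"
    using True by (simp add: s_def height_def complex_eq_iff)
  then have "\<omega> * (cis (- (Arg2pi a / 2)) * z) = \<omega> * of_real s" by simp
  then have z: "z = \<omega> * of_real s"
    by (simp add: \<omega>_def cis_mult flip: mult.assoc)
  have a: "a = of_real (cmod a) * \<omega>\<^sup>2"
  proof -
    have "\<omega>\<^sup>2 = cis (Arg2pi a)"
      by (simp add: \<omega>_def power2_eq_square cis_mult)
    then show ?thesis
      using Arg2pi_eq[of a] by (simp add: cis_conv_exp)
  qed
  have "quad a z = of_real (s\<^sup>2 + cmod a) * \<omega>\<^sup>2"
    unfolding quad_def z by (subst a) (simp add: power_mult_distrib algebra_simps)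
  then have "height a (quad a z) = Im (of_real (s\<^sup>2 + cmod a) * (cis (- (Arg2pi a / 2)) * \<omega>\<^sup>2))"
    by (simp add: height_def mult.left_commute)
  also have "cis (- (Arg2pi a / 2)) * \<omega>\<^sup>2 = \<omega>"
    by (simp add: \<omega>_def power2_eq_square cis_mult)
  also have "Im (of_real (s\<^sup>2 + cmod a) * \<omega>) = (s\<^sup>2 + cmod a) * sin (Arg2pi a / 2)"
    by (simp add: \<omega>_def)
  also have "\<dots> \<ge> 0"
    using Arg2pi_ge_0[of a] Arg2pi_lt_2pi[of a]
    by (intro mult_nonneg_nonneg sin_ge_zero) auto
  finally have "height a (quad a z) > - t"
    using assms(2) by simp
  moreover have "cmod (quad a z - a) < R\<^sup>2"
    using assms(3) by (simp add: quad_def norm_power power_strict_mono)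
  ultimately show ?thesis
    by (simp add: D_def W1_def)
qed

lemma D_disjoint: "z \<in> D a R t 0 \<Longrightarrow> z \<notin> D a R t 2"
  by (simp add: D_def)

lemma openin_less:
  fixes f g :: "'a::topological_space \<Rightarrow> real"
  assumes "continuous_on S f" "continuous_on S g"
  shows "openin (top_of_set S) {s \<in> S. f s < g s}"
proof -
  have "{s \<in> S. f s < g s} = S \<inter> (\<lambda>s. g s - f s) -` {0<..}" by auto
  then show ?thesis
    using assms by (auto intro!: continuous_openin_preimage_gen continuous_intros)
qed

lemma openin_conj:
  assumes "openin (top_of_set S) {s \<in> S. P s}" "openin (top_of_set S) {s \<in> S. Q s}"
  shows "openin (top_of_set S) {s \<in> S. P s \<and> Q s}"
  using openin_Int[OF assms] by (rule back_subst) auto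

text \<open>Strict inequalities between continuous functions define the pieces, so membership is
  open in the point and the parameters jointly.\<close>

lemma openin_D:
  assumes A: "continuous_on S A" "\<And>s. s \<in> S \<Longrightarrow> Re (A s) < 0"
    and R: "continuous_on S R" and t: "continuous_on S t" and x: "continuous_on S x"
  shows "openin (top_of_set S) {s \<in> S. x s \<in> D (A s) (R s) (t s) i}"
proof -
  have h: "continuous_on S (\<lambda>s. height (A s) (x s))" "continuous_on S (\<lambda>s. height (A s) ((x s)\<^sup>2 + A s))"
    using A x by (auto intro!: continuous_on_height continuous_intros)
  consider "i = 0" | "i = 1" | "i = 2" | "i > 2" by linarith
  then show ?thesis
  proof cases
    case 1
    then show ?thesis
      using h R x by (simp add: D_def del: zero_less_norm_iff) (intro openin_conj openin_less continuous_intros; simp)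
  next
    case 2
    then show ?thesis
      using h R x A t by (simp add: D_def W1_def quad_def)
        (intro openin_conj openin_less continuous_intros; simp)
  next
    case 3
    then show ?thesis
      using h R x by (simp add: D_def del: zero_less_norm_iff) (intro openin_conj openin_less continuous_intros; simp)
  next
    case 4
    then show ?thesis by (simp add: D_def)
  qed
qed

section \<open>Itineraries of a periodic orbit\<close>

lemma Sigma_G_step:
  assumes "i \<in> Sigma_G"
  shows "i n \<in> {0, 1, 2}" "i (n + 1) = 2 \<longleftrightarrow> i n = 1"
  using assms unfolding Sigma_G_def by (auto dest!: spec[of _ n])

lemma periodic_multiple:
  fixes x :: "int \<Rightarrow> 'a"
  assumes "\<And>n. x (n + N) = x n"
  shows "x (k + q * N) = x k"
proof (induction q rule: int_induct [where k = 0])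
  case base
  show ?case by simp
next
  case (step1 q)
  then show ?case
    using assms[of "k + q * N"] by (simp add: algebra_simps)
next
  case (step2 q)
  then show ?case
    using assms[of "k + (q - 1) * N"] by (simp add: algebra_simps)
qed

text \<open>Where two itineraries of one orbit disagree, one of them is at 1, so its next symbol is 2;
  as \<open>D\<^sub>0 \<inter> D\<^sub>2 = \<emptyset>\<close> the other one is then at 1. So they disagree from there on and the
  orbit stays in \<open>D\<^sub>2\<close>.\<close>

lemma itinerary_unique:
  assumes i: "(x, i) \<in> Xhat a R t e" and j: "(x, j) \<in> Xhat a R t e"
    and per: "\<And>n. x (n + int N) = x n" "0 < N" and zero: "i m = 0"
  shows "j = i"
proof (rule ccontr)
  assume "j \<noteq> i"
  then obtain n where n: "i n \<noteq> j n" by (metis ext)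
  have G: "i \<in> Sigma_G" "j \<in> Sigma_G" and D: "\<And>n. x n \<in> D a R t (i n)" "\<And>n. x n \<in> D a R t (j n)"
    using i j by (auto simp: Xhat_def)
  have one: "i n = 1 \<or> j n = 1" if "i n \<noteq> j n" for n
    using D(1)[of n] D(2)[of n] Sigma_G_step(1)[OF G(1), of n] Sigma_G_step(1)[OF G(2), of n]
      D_disjoint[of "x n"] that by auto
  have step: "i (n + 1) \<noteq> j (n + 1) \<and> (i (n + 1) = 2 \<or> j (n + 1) = 2)" if "i n \<noteq> j n" for n
    using one[OF that] Sigma_G_step(2)[OF G(1), of n] Sigma_G_step(2)[OF G(2), of n] that by auto
  have later: "i (n + int k) \<noteq> j (n + int k)" for k
  proof (induction k)
    case 0
    then show ?case using n by simp
  next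
    case (Suc k)
    then show ?case using step[OF Suc] by (simp add: algebra_simps)
  qed
  have D2: "x (n + int k + 1) \<in> D a R t 2" for k
    using step[OF later[of k]] D by metis
  have per': "x (k + int q * int N) = x k" for k q
    by (rule periodic_multiple) (rule per)
  \<comment> \<open>Enough periods to carry m beyond n, where the orbit stays in the piece with
    index 2; by periodicity \<open>x m\<close> lies there as well.\<close>
  define q where "q = nat (\<bar>n\<bar> + \<bar>m\<bar> + 1)"
  have "n + 1 \<le> m + int q * 1" by (simp add: q_def)
  also have "\<dots> \<le> m + int q * int N"
    using per(2) by (intro add_left_mono mult_left_mono) auto
  finally have "x (m + int q * int N) \<in> D a R t 2"
    using D2[of "nat (m + int q * int N - n - 1)"] by simp
  then have "x m \<in> D a R t 2"
    by (simp add: per')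
  with D(1)[of m] zero show False
    using D_disjoint by metis
qed

text \<open>At the base point index 0 forces the symbol 1 and index 2 the symbol 0. The piece with
  index 1 straddles the line x = 0 and leaves the symbol free.\<close>

definition compatible :: "nat \<Rightarrow> bool \<Rightarrow> bool" where
  "compatible i s \<longleftrightarrow> (i = 0 \<longrightarrow> s) \<and> (i = 2 \<longrightarrow> \<not> s)"

context real_HOV
begin

lemma compatible_coding:
  assumes "xcoord c p n \<in> D (fst c) r u i"
  shows "compatible i (coding c p n)"
  using assms height_real[OF real neg] by (auto simp: compatible_def D_def coding_eq)

text \<open>An itinerary chosen at the start of the loop survives to its end, where it is read
  against the symbols of the image point.\<close>

lemma rho_pi1_W_periodic:
  assumes adm: "admissible R t \<epsilon>" and \<phi>: "\<phi> \<in> rho_pi1 c (W_region R \<epsilon> \<inter> U)"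
    and p: "p \<in> K c" "iter (henon c) (int N) p = p" "0 < N"
    and pp: "coding c p m" "coding c p (m + 1)"
  obtains i where "i \<in> Sigma_G"
    "\<And>n. compatible (i n) (coding c p n) \<and> compatible (i n) (\<phi> (coding c p) n)"
proof -
  obtain \<gamma> g where path: "path \<gamma>" "path_image \<gamma> \<subseteq> W_region R \<epsilon> \<inter> U" and \<gamma>: "\<gamma> 0 = c" "\<gamma> 1 = c"
    and fam: "conjugacy_family \<gamma> g"
    and "conjugacy (K c) (henon c) (K c) (henon c) (g 1)" and g0: "\<And>p. p \<in> K c \<Longrightarrow> g 0 p = p"
    and \<phi>: "\<And>p. p \<in> K c \<Longrightarrow> \<phi> (coding c p) = coding c (g 1 p)"
    and "\<phi> = coding c \<circ> g 1 \<circ> inv_into (K c) (coding c)"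
    using \<phi> by (rule rho_pi1E) (rule that; assumption)
  let ?I = "{0..1 :: real}"
  define A where "A s = fst (\<gamma> s)" for s
  define X where "X n s = fst (g s (iter (henon c) n p))" for n s
  define \<D> where "\<D> s = D (A s) (R (A s)) (t (A s))" for s
  define XH where "XH s = Xhat (A s) (R (A s)) (t (A s)) (\<epsilon> (A s))" for s
  have W: "A s \<in> Wbase" "snd (\<gamma> s) \<noteq> 0" "cmod (snd (\<gamma> s)) < \<epsilon> (A s) / R (A s)" if "s \<in> ?I" for s
  proof -
    have "\<gamma> s \<in> W_region R \<epsilon>"
      using path(2) that by (auto simp: path_image_def)
    then show "A s \<in> Wbase" "snd (\<gamma> s) \<noteq> 0" "cmod (snd (\<gamma> s)) < \<epsilon> (A s) / R (A s)"
      by (auto simp: A_def W_region_def)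
  qed
  then have Re: "Re (A s) < 0" if "s \<in> ?I" for s
    using that Wbase_Re by blast
  have adm_at: "admissible_at (A s) (R (A s)) (t (A s)) (\<epsilon> (A s))" if "s \<in> ?I" for s
    using adm W[OF that] by (simp add: admissible_def)
  then have pos: "0 < R (A s)" "0 < t (A s)" if "s \<in> ?I" for s
    using that by (auto simp: admissible_at_def)
  have conj: "conjugacy (K c) (henon c) (K (\<gamma> s)) (henon (\<gamma> s)) (g s)" if "s \<in> ?I" for s
    using fam that unfolding conjugacy_family_def \<gamma> by blast
  have X: "X n s = xcoord (\<gamma> s) (g s p) n" if "s \<in> ?I" for n s
    using conjugacy_iter[OF conj[OF that] snd_nonzero W(2)[OF that] p(1)]
    by (simp add: X_def xcoord_def)
  have per: "X (n + int N) s = X n s" for n s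
    by (simp add: X_def iter_add[OF bij_henon[OF snd_nonzero]] p(2))
  have X_less: "cmod (X n s) < R (A s)" if "s \<in> ?I" for n s
  proof -
    have "g s (iter (henon c) n p) \<in> K (\<gamma> s)"
      using conjugacy_in[OF conj[OF that]] iter_in_K[OF snd_nonzero p(1)] by blast
    moreover have "K (A s, snd (\<gamma> s)) \<subseteq> {(x, y). cmod x < R (A s) \<and> cmod y < R (A s)}"
      using adm_at[OF that] W[OF that] unfolding admissible_at_def by simp
    ultimately show ?thesis
      by (auto simp: A_def X_def split: prod.splits)
  qed
  \<comment> \<open>The x-coordinates form a pseudo-orbit of the quadratic map, with error |b|
    |x_(n-1)| < \<epsilon>.\<close>
  have orb: "(\<lambda>n. X n s) \<in> Orb (A s) (R (A s)) (t (A s)) (\<epsilon> (A s))" if s: "s \<in> ?I" for s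
    unfolding Orb_def mem_Collect_eq
  proof (intro allI conjI)
    fix n
    show "X n s \<in> D (A s) (R (A s)) (t (A s)) 0 \<union> D (A s) (R (A s)) (t (A s)) 1 \<union> D (A s) (R (A s)) (t (A s)) 2"
      using Re[OF s] pos[OF s] X_less[OF s] by (intro D_cover)
    have "X (n + 1) s - quad (A s) (X n s) = - (snd (\<gamma> s) * X (n - 1) s)"
      using xcoord_rec[OF W(2)[OF s], of "g s p" n] by (simp add: X[OF s] quad_def A_def)
    then have "cmod (X (n + 1) s - quad (A s) (X n s)) = cmod (snd (\<gamma> s)) * cmod (X (n - 1) s)"
      by (simp add: norm_mult)
    also have "\<dots> \<le> cmod (snd (\<gamma> s)) * R (A s)"
      using X_less[OF s] by (intro mult_left_mono) (auto simp: less_imp_le)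
    also have "\<dots> < \<epsilon> (A s)"
      using W(3)[OF s] pos[OF s] by (simp add: pos_less_divide_eq)
    finally show "cmod (X (n + 1) s - quad (A s) (X n s)) < \<epsilon> (A s)" .
  qed
  have some: "\<exists>i. ((\<lambda>n. X n s), i) \<in> XH s" if "s \<in> ?I" for s
    using adm_at[OF that] orb[OF that] unfolding admissible_at_def XH_def by blast
  define T where "T j = {s \<in> ?I. \<forall>n. X n s \<in> \<D> s (j n)}" for j
  have T_XH: "s \<in> T j \<longleftrightarrow> ((\<lambda>n. X n s), j) \<in> XH s" if "s \<in> ?I" "j \<in> Sigma_G" for s j
    using orb[OF that(1)] that by (simp add: T_def XH_def Xhat_def \<D>_def)
  have contA: "continuous_on ?I A"
    using path(1) unfolding path_def A_def [abs_def] by (intro continuous_intros)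
  have openT: "openin (top_of_set ?I) (T j)" if "j \<in> Sigma_G" for j
  proof -
    \<comment> \<open>The orbit has period N, so only finitely many pairs of a residue and an index
      occur, even if j is not periodic. A finite intersection of relatively open sets
      results.\<close>
    define S where "S = range (\<lambda>n. (n mod int N, j n))"
    have "S \<subseteq> {0..<int N} \<times> {0, 1, 2}"
      unfolding S_def
    proof (rule image_subsetI)
      show "(n mod int N, j n) \<in> {0..<int N} \<times> {0, 1, 2}" for n
        using Sigma_G_step(1)[OF that, of n] p(3) by simp
    qed
    then have fin: "finite S"
      by (rule finite_subset) simp
    have op: "openin (top_of_set ?I) {s \<in> ?I. X (fst mv) s \<in> \<D> s (snd mv)}" for mv
      unfolding \<D>_def
    proof (rule openin_D)
      show "continuous_on ?I A" "\<And>s. s \<in> ?I \<Longrightarrow> Re (A s) < 0"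
        by (fact contA, fact Re)
      show "continuous_on ?I (\<lambda>s. R (A s))" "continuous_on ?I (\<lambda>s. t (A s))"
        using adm W(1) unfolding admissible_def
        by (auto intro!: continuous_on_compose2[where t = Wbase, OF _ contA])
      show "continuous_on ?I (X (fst mv))"
        unfolding X_def [abs_def] using iter_in_K[OF snd_nonzero p(1)]
        by (intro continuous_intros continuous_on_family[OF fam]) (simp only: \<gamma>)
    qed
    have T: "T j = (\<Inter>mv\<in>S. {s \<in> ?I. X (fst mv) s \<in> \<D> s (snd mv)})"
    proof -
      have "X (n mod int N) s = X n s" for n s
        using periodic_multiple[where x = "\<lambda>n. X n s" and N = "int N" and k = "n mod int N"
            and q = "n div int N"] per
        by simp
      then show ?thesis
        by (auto simp: T_def S_def)
    qed
    have ne: "S \<noteq> {}"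
      by (simp add: S_def)
    show ?thesis
      unfolding T by (rule openin_INT2[OF fin ne op])
  qed
  obtain i where i: "((\<lambda>n. X n 0), i) \<in> XH 0"
    using some[of 0] by auto
  then have iG: "i \<in> Sigma_G"
    by (auto simp: XH_def Xhat_def)
  have i0: "compatible (i n) (coding c p n)" for n
  proof (rule compatible_coding)
    show "xcoord c p n \<in> D (fst c) (R (fst c)) (t (fst c)) (i n)"
      using i X[of 0] g0[OF p(1)] by (auto simp: XH_def Xhat_def A_def \<gamma>)
  qed
  \<comment> \<open>Index 2 contradicts the symbol 1 at m, and index 1 would force index 2 at m + 1,
    where the symbol is again 1.\<close>
  have "i m = 0"
    using Sigma_G_step[OF iG, of m] i0[of m] i0[of "m + 1"] pp by (auto simp: compatible_def)
  then have unique: "j = i" if "s \<in> ?I" "((\<lambda>n. X n s), i) \<in> XH s" "((\<lambda>n. X n s), j) \<in> XH s" for s j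
    using that itinerary_unique[where x = "\<lambda>n. X n s" and N = N] per p(3) unfolding XH_def by blast
  \<comment> \<open>Every time has an itinerary, and a time that admits i admits no other. So the
    complement is a union of open sets, and \<open>T i\<close> is clopen in the interval.\<close>
  have "?I - T i = \<Union> (T ` {j \<in> Sigma_G. j \<noteq> i})"
  proof (intro equalityI subsetI)
    fix s assume s: "s \<in> ?I - T i"
    then obtain j where j: "((\<lambda>n. X n s), j) \<in> XH s"
      using some by blast
    then have "j \<in> Sigma_G" by (auto simp: XH_def Xhat_def)
    with s j show "s \<in> \<Union> (T ` {j \<in> Sigma_G. j \<noteq> i})"
      using T_XH[of s] by auto
  next
    fix s assume "s \<in> \<Union> (T ` {j \<in> Sigma_G. j \<noteq> i})"
    then obtain j where j: "j \<in> Sigma_G" "j \<noteq> i" "s \<in> T j" by auto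
    then have "s \<in> ?I" by (simp add: T_def)
    with j show "s \<in> ?I - T i"
      using T_XH[of s] unique[of s j] iG by auto
  qed
  moreover have "openin (top_of_set ?I) (\<Union> (T ` {j \<in> Sigma_G. j \<noteq> i}))"
    using openT by (intro openin_Union) auto
  moreover have "T i \<subseteq> ?I"
    by (auto simp: T_def)
  ultimately have "closedin (top_of_set ?I) (T i)"
    by (simp add: closedin_def)
  moreover have "0 \<in> T i"
    using T_XH[of 0 i] i iG by simp
  ultimately have "T i = ?I"
    using connected_clopen[of ?I] openT[OF iG] by fastforce
  then have "1 \<in> T i" by simp
  have i1: "compatible (i n) (coding c (g 1 p) n)" for n
  proof (intro compatible_coding)
    show "xcoord c (g 1 p) n \<in> D (fst c) (R (fst c)) (t (fst c)) (i n)"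
      using \<open>1 \<in> T i\<close> X[of 1] by (auto simp: T_def \<D>_def A_def \<gamma>)
  qed
  show ?thesis
    using that[OF iG] i0 i1 \<phi>[OF p(1)] by simp
qed

end

section \<open>Approximation by periodic sequences\<close>

lemma open_sigma2_cylinder:
  fixes U :: "sigma2 set"
  assumes "open U" "s \<in> U"
  shows "\<exists>M::nat. \<forall>s'. (\<forall>n. \<bar>n\<bar> \<le> int M \<longrightarrow> s' n = s n) \<longrightarrow> s' \<in> U"
proof -
  obtain X where X: "s \<in> (\<Pi>\<^sub>E i\<in>UNIV. X i)" "finite {i. X i \<noteq> (UNIV :: bool set)}"
    "(\<Pi>\<^sub>E i\<in>UNIV. X i) \<subseteq> U"
    using product_topology_open_contains_basis[of "\<lambda>i. euclidean" UNIV U s] assms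
    by (auto simp: open_fun_def)
  obtain M :: nat where M: "\<And>i. X i \<noteq> UNIV \<Longrightarrow> nat \<bar>i\<bar> \<le> M"
    using X(2) finite_nat_set_iff_bounded_le[of "(\<lambda>i. nat \<bar>i\<bar>) ` {i. X i \<noteq> UNIV}"] by auto
  have "s' \<in> U" if "\<And>n. \<bar>n\<bar> \<le> int M \<Longrightarrow> s' n = s n" for s'
  proof -
    have "s' i \<in> X i" for i
    proof (cases "X i = UNIV")
      case False
      then have "s' i = s i" using M that by (simp add: nat_le_iff)
      then show ?thesis using X(1) by auto
    qed simp
    then show ?thesis using X(3) by auto
  qed
  then show ?thesis by blast
qed

text \<open>The padding by two symbols 1 makes the symbol 0 occur in every itinerary of the sequence.\<close>

definition periodize :: "nat \<Rightarrow> sigma2 \<Rightarrow> sigma2" where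
  "periodize M s n = (let r = (n + int M) mod (2 * int M + 3) in r \<le> 2 * int M \<longrightarrow> s (r - int M))"

lemma periodize_periodic: "periodize M s (n + int (2 * M + 3)) = periodize M s n"
proof -
  have "(n + int (2 * M + 3) + int M) mod (2 * int M + 3) = (n + int M + (2 * int M + 3)) mod (2 * int M + 3)"
    by (simp add: algebra_simps)
  also have "\<dots> = (n + int M) mod (2 * int M + 3)"
    by (rule mod_add_self2)
  finally show ?thesis
    by (simp only: periodize_def)
qed

lemma periodize_eq: "\<bar>n\<bar> \<le> int M \<Longrightarrow> periodize M s n = s n"
  by (auto simp: periodize_def Let_def)

lemma periodize_True: "periodize M s (int M + 1)" "periodize M s (int M + 1 + 1)"
  by (simp_all add: periodize_def Let_def)

context real_HOV
begin

text \<open>A periodic sequence close to s has a common itinerary with its image; continuity of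
  \<phi> transfers this to s on the window. The itinerary may vary with M.\<close>

lemma rho_pi1_W_window:
  assumes adm: "admissible R t \<epsilon>" and \<phi>: "\<phi> \<in> rho_pi1 c (W_region R \<epsilon> \<inter> U)"
  shows "\<exists>i\<in>Sigma_G. \<forall>n. \<bar>n\<bar> \<le> int M \<longrightarrow> compatible (i n) (s n) \<and> compatible (i n) (\<phi> s n)"
proof -
  have "continuous_on UNIV \<phi>"
    using \<phi> rho_pi1_subset_Aut carrier_Aut by blast
  then have "open ((\<lambda>s'. \<phi> s' n) -` {\<phi> s n})" for n
    by (auto intro!: open_vimage continuous_on_product_then_coordinatewise open_discrete)
  then have "open (\<Inter>n\<in>{- int M..int M}. (\<lambda>s'. \<phi> s' n) -` {\<phi> s n})"
    by (intro open_INT) auto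
  then have "\<exists>M'::nat. \<forall>s'. (\<forall>n. \<bar>n\<bar> \<le> int M' \<longrightarrow> s' n = s n) \<longrightarrow>
      s' \<in> (\<Inter>n\<in>{- int M..int M}. (\<lambda>s'. \<phi> s' n) -` {\<phi> s n})"
    by (rule open_sigma2_cylinder) simp
  then obtain M' :: nat where M': "\<forall>s'. (\<forall>n. \<bar>n\<bar> \<le> int M' \<longrightarrow> s' n = s n) \<longrightarrow>
      s' \<in> (\<Inter>n\<in>{- int M..int M}. (\<lambda>s'. \<phi> s' n) -` {\<phi> s n})" ..
  \<comment> \<open>Radius M secures agreement of the sequences on the window, radius M' agreement
    of their images.\<close>
  define L where "L = max M M'"
  define s' where "s' = periodize L s"
  have s': "s' n = s n" if "\<bar>n\<bar> \<le> int L" for n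
    using that by (simp add: s'_def periodize_eq)
  have \<phi>s': "\<phi> s' n = \<phi> s n" if "\<bar>n\<bar> \<le> int M" for n
  proof -
    have "s' \<in> (\<Inter>n\<in>{- int M..int M}. (\<lambda>s'. \<phi> s' n) -` {\<phi> s n})"
      by (rule M'[rule_format]) (simp add: s' L_def)
    moreover have "n \<in> {- int M..int M}" using that by auto
    ultimately show ?thesis by blast
  qed
  let ?N = "2 * L + 3"
  obtain p where p: "p \<in> K c" "coding c p = s'"
    using surj_on_coding by (metis UNIV_I imageE)
  have "coding c (iter (henon c) (int ?N) p) = coding c p"
  proof
    fix n
    have "coding c (iter (henon c) (int ?N) p) n = coding c p (n + int ?N)"
      by (simp only: coding_eq xcoord_iter[OF snd_nonzero])
    also have "\<dots> = coding c p n"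
      unfolding p(2) s'_def by (rule periodize_periodic)
    finally show "coding c (iter (henon c) (int ?N) p) n = coding c p n" .
  qed
  then have per: "iter (henon c) (int ?N) p = p"
    using inj_onD[OF inj_on_coding] iter_in_K[OF snd_nonzero p(1)] p(1) by blast
  obtain i where i: "i \<in> Sigma_G"
    "\<And>n. compatible (i n) (coding c p n) \<and> compatible (i n) (\<phi> (coding c p) n)"
  proof (rule rho_pi1_W_periodic[OF adm \<phi> p(1) per])
    show "0 < ?N" by simp
    show "coding c p (int L + 1)" "coding c p (int L + 1 + 1)"
      unfolding p(2) s'_def by (fact periodize_True)+
  qed (rule that)
  have "compatible (i n) (s n) \<and> compatible (i n) (\<phi> s n)" if "\<bar>n\<bar> \<le> int M" for n
    using i(2)[of n] s'[of n] \<phi>s'[OF that] that unfolding p(2) by (simp add: L_def)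
  with i(1) show ?thesis by blast
qed

end

section \<open>The parity of points of period four\<close>

definition per4 :: "sigma2 set" where
  "per4 = {s. (\<forall>n. s (n + 4) = s n) \<and> \<not> (\<forall>n. s (n + 2) = s n)}"

text \<open>\<open>parity\<close> splits the twelve points of \<^const>\<open>per4\<close> into two classes of six, which the shift
  exchanges; it holds on the shift-squared orbits of 1110, 1100 and 0100.\<close>

definition parity :: "sigma2 \<Rightarrow> bool" where
  "parity s \<longleftrightarrow> s 0 = s 2 \<or> s 1 \<noteq> s 3 \<and> s 0 = s 1"

text \<open>The two classes may be exchanged, as the shift does, but only as a whole: d is the same
  for all points.\<close>

definition parity_respecting :: "(sigma2 \<Rightarrow> sigma2) \<Rightarrow> bool" where
  "parity_respecting \<phi> \<longleftrightarrow> (\<exists>d. \<forall>s\<in>per4. parity (\<phi> s) \<longleftrightarrow> parity s \<noteq> d)"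

lemma per4_iff_shift: "s \<in> per4 \<longleftrightarrow> (shift ^^ 4) s = s \<and> (shift ^^ 2) s \<noteq> s"
proof -
  have "(shift ^^ k) s n = s (n + int k)" for k n
    by (induction k arbitrary: n) (simp_all add: shift_def algebra_simps)
  then show ?thesis
    by (simp add: per4_def fun_eq_iff)
qed

text \<open>Reduces statements about a point of \<open>per4\<close> to its symbols at 0, 1, 2, 3;
  the last clause excludes period 2.\<close>

lemma per4_values:
  assumes "s \<in> per4"
  shows "s 4 = s 0" "s 5 = s 1" "s 6 = s 2" "s 7 = s 3" "s 8 = s 0" "s 0 = s 2 \<Longrightarrow> s 1 \<noteq> s 3"
proof -
  have per: "s (n + 4) = s n" for n using assms by (simp add: per4_def)
  from per[of 0] per[of 1] per[of 2] per[of 3] per[of 4]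
  show v: "s 4 = s 0" "s 5 = s 1" "s 6 = s 2" "s 7 = s 3" "s 8 = s 0" by simp_all
  show "s 1 \<noteq> s 3" if "s 0 = s 2"
  proof
    assume 13: "s 1 = s 3"
    have "s (n + 2) = s n" for n
    proof -
      have "s k = s (k mod 4)" for k
        using periodic_multiple[where x = s and k = "k mod 4" and N = 4 and q = "k div 4"] per by simp
      then have "s n = s (n mod 4)" "s (n + 2) = s ((n mod 4 + 2) mod 4)"
        by (simp_all add: mod_add_left_eq)
      moreover have "n mod 4 \<in> {0, 1, 2, 3}"
        by auto
      ultimately show ?thesis
        using that 13 by auto
    qed
    then show False using assms by (simp add: per4_def)
  qed
qed

lemma Aut_per4:
  assumes "\<phi> \<in> carrier Aut_sigma2"
  shows "\<phi> s \<in> per4 \<longleftrightarrow> s \<in> per4"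
proof -
  have "\<phi> (shift s) = shift (\<phi> s)" for s
    using assms by (simp add: carrier_Aut)
  then have "\<phi> ((shift ^^ k) s) = (shift ^^ k) (\<phi> s)" for k
    by (induction k) simp_all
  moreover have "\<phi> u = \<phi> v \<longleftrightarrow> u = v" for u v
    using assms unfolding carrier_Aut by metis
  ultimately show ?thesis
    by (metis per4_iff_shift)
qed

text \<open>Automorphisms permute \<open>per4\<close>, so respecting the partition passes to
  inverses and to products, where the values of d add modulo 2.\<close>

lemma parity_respecting_generate:
  assumes S: "S \<subseteq> carrier Aut_sigma2" "\<And>\<phi>. \<phi> \<in> S \<Longrightarrow> parity_respecting \<phi>"
    and \<phi>: "\<phi> \<in> generate Aut_sigma2 S"
  shows "parity_respecting \<phi>"
  using \<phi>
proof (induction rule: generate.induct)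
  case one
  show ?case
    by (auto simp: parity_respecting_def)
next
  case (incl \<phi>)
  then show ?case by (rule S(2))
next
  case (inv \<phi>)
  interpret group Aut_sigma2 by (rule group_Aut)
  let ?\<psi> = "inv\<^bsub>Aut_sigma2\<^esub> \<phi>"
  have \<phi>: "\<phi> \<in> carrier Aut_sigma2" using inv S(1) by blast
  obtain d where d: "\<And>s. s \<in> per4 \<Longrightarrow> parity (\<phi> s) \<longleftrightarrow> parity s \<noteq> d"
    using S(2)[OF inv] by (auto simp: parity_respecting_def)
  have "\<phi> (?\<psi> s) = s" for s
    using fun_cong[OF r_inv[OF \<phi>, simplified]] by simp
  then have "parity (?\<psi> s) \<longleftrightarrow> parity s \<noteq> d" if "s \<in> per4" for s
    using d[of "?\<psi> s"] Aut_per4[OF inv_closed[OF \<phi>]] that by auto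
  then show ?case
    by (auto simp: parity_respecting_def)
next
  case (eng \<phi> \<psi>)
  then obtain d d' where d: "\<And>s. s \<in> per4 \<Longrightarrow> parity (\<phi> s) \<longleftrightarrow> parity s \<noteq> d"
    "\<And>s. s \<in> per4 \<Longrightarrow> parity (\<psi> s) \<longleftrightarrow> parity s \<noteq> d'"
    by (auto simp: parity_respecting_def)
  have "\<psi> \<in> carrier Aut_sigma2"
    using group.generate_in_carrier[OF group_Aut S(1) eng.hyps(2)] .
  then have "parity (\<phi> (\<psi> s)) \<longleftrightarrow> parity s \<noteq> (d \<noteq> d')" if "s \<in> per4" for s
    using d that Aut_per4 by auto
  then show ?case
    unfolding parity_respecting_def by (intro exI[of _ "d \<noteq> d'"]) simp
qed

lemma parity_respecting_shift: "parity_respecting shift"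
proof -
  have "parity (shift s) \<longleftrightarrow> parity s \<noteq> True" if "s \<in> per4" for s
    using per4_values[OF that] by (auto simp: parity_def shift_def)
  then show ?thesis
    unfolding parity_respecting_def by blast
qed

text \<open>\<open>parity\<close> only compares symbols with one another, so a simultaneous exchange
  leaves it unchanged.\<close>

lemma parity_respecting_flip: "(\<And>s n. \<phi> s n \<longleftrightarrow> s n \<noteq> d) \<Longrightarrow> parity_respecting \<phi>"
  by (auto simp: parity_respecting_def parity_def)

text \<open>With e marking index 1, index 2 stands exactly one place later, so e determines the
  itinerary. A compatible sequence is then free only where e holds, and for period 4 this freedom
  cannot change the parity.\<close>

lemma parity_eq_itinerary:
  assumes s: "s \<in> per4" "s' \<in> per4" and i: "i \<in> Sigma_G"
    and compat: "\<And>n. \<bar>n\<bar> \<le> 8 \<Longrightarrow> compatible (i n) (s n) \<and> compatible (i n) (s' n)"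
  shows "parity s' = parity s"
proof -
  define e where "e n \<longleftrightarrow> i n = 1" for n
  have c: "(s n \<longrightarrow> \<not> e (n - 1)) \<and> (\<not> s n \<longrightarrow> e n \<or> e (n - 1)) \<and>
      (s' n \<longrightarrow> \<not> e (n - 1)) \<and> (\<not> s' n \<longrightarrow> e n \<or> e (n - 1)) \<and> \<not> (e n \<and> e (n - 1))"
    if "\<bar>n\<bar> \<le> 8" for n
    using compat[OF that] Sigma_G_step(1)[OF i, of n] Sigma_G_step(2)[OF i, of "n - 1"]
    by (auto simp: compatible_def e_def)
  \<comment> \<open>The itinerary need not be periodic, so constraints from nearly two periods are
    collected; a propositional check remains.\<close>
  note c [of 1, simplified] c [of 2, simplified] c [of 3, simplified] c [of 4, simplified]
    c [of 5, simplified] c [of 6, simplified] c [of 7, simplified]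
  with per4_values[OF s(1)] per4_values[OF s(2)] show ?thesis
    unfolding parity_def by argo
qed

lemma (in real_HOV) parity_respecting_W:
  assumes "admissible R t \<epsilon>" "\<phi> \<in> rho_pi1 c (W_region R \<epsilon> \<inter> U)"
  shows "parity_respecting \<phi>"
proof -
  have "parity (\<phi> s) = parity s" if s: "s \<in> per4" for s
  proof -
    obtain i where "i \<in> Sigma_G"
      "\<forall>n. \<bar>n\<bar> \<le> int 8 \<longrightarrow> compatible (i n) (s n) \<and> compatible (i n) (\<phi> s n)"
      using rho_pi1_W_window[OF assms] by blast
    moreover have "\<phi> s \<in> per4"
      using assms(2) rho_pi1_subset_Aut Aut_per4 s by blast
    ultimately show ?thesis
      using parity_eq_itinerary[OF s] by simp
  qed
  then show ?thesis
    by (auto simp: parity_respecting_def)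
qed

lemma (in real_HOV) parity_respecting_HOV:
  assumes "\<phi> \<in> rho_pi1 c HOV"
  shows "parity_respecting \<phi>"
  using rho_pi1_HOV[OF assms] parity_respecting_flip by metis

section \<open>A marker automorphism that does not respect the parity\<close>

definition marker :: "sigma2 \<Rightarrow> int \<Rightarrow> bool" where
  "marker s n \<longleftrightarrow> \<not> s (n - 1) \<and> s (n + 1) \<and> s (n + 2) \<and> \<not> s (n + 3)"

definition marker_flip :: "sigma2 \<Rightarrow> sigma2" where
  "marker_flip s n \<longleftrightarrow> s n \<noteq> marker s n"

text \<open>The star of one occurrence of 0*110 is never a fixed symbol of another, so flipping
  neither creates nor destroys occurrences.\<close>

lemma marker_flip_involution: "marker_flip (marker_flip s) = s"
proof
  fix n
  have "marker (marker_flip s) n = marker s n"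
    by (simp add: marker_def marker_flip_def algebra_simps) argo
  then show "marker_flip (marker_flip s) n = s n"
    by (subst marker_flip_def) (auto simp: marker_flip_def)
qed

lemma marker_flip_in_Aut: "marker_flip \<in> carrier Aut_sigma2"
proof -
  have ev: "eventually (\<lambda>s'. s' n = s n) (at s)" for s :: sigma2 and n
    using continuous_on_shift_index[of n] by (simp add: continuous_on tendsto_discrete)
  have "eventually (\<lambda>s'. marker_flip s' n = marker_flip s n) (at s)" for s n
    using ev[of n s] ev[of "n - 1" s] ev[of "n + 1" s] ev[of "n + 2" s] ev[of "n + 3" s]
    by eventually_elim (simp add: marker_flip_def marker_def)
  then have "continuous_on UNIV marker_flip"
    by (intro continuous_on_coordinatewise_then_product) (simp add: continuous_on tendsto_discrete)
  moreover have "marker_flip (shift s) = shift (marker_flip s)" for s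
    by (auto simp: marker_flip_def marker_def shift_def algebra_simps fun_eq_iff)
  ultimately show ?thesis
    using marker_flip_involution unfolding carrier_Aut by blast
qed

lemma not_parity_respecting_marker_flip: "\<not> parity_respecting marker_flip"
proof
  \<comment> \<open>\<open>u\<close> repeats 1110 and becomes 0110, of the other parity;
    \<open>v\<close> repeats 0100, which contains no 11 and hence no marker.\<close>
  define u v :: sigma2 where "u = (\<lambda>n. n mod 4 \<noteq> 3)" and "v = (\<lambda>n. n mod 4 = 1)"
  have uv: "u \<in> per4" "v \<in> per4"
    unfolding per4_def mem_Collect_eq by (auto simp: u_def v_def intro!: exI[of _ 1])
  assume "parity_respecting marker_flip"
  then have "(parity (marker_flip u) = parity u) = (parity (marker_flip v) = parity v)"
    using uv unfolding parity_respecting_def by auto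
  then show False
    by (simp add: parity_def marker_flip_def marker_def u_def v_def)
qed

theorem theorem2:
  fixes R t \<epsilon> :: "complex \<Rightarrow> real" and c :: "complex \<times> complex"
  assumes "admissible R t \<epsilon>"
    and "c \<in> HOV \<inter> W_region R \<epsilon>"
    and "fst c \<in> \<real>" and "snd c \<in> \<real>" and "Re (fst c) < 0"
  defines "H \<equiv> generate Aut_sigma2
      (rho_pi1 c HOV \<union> rho_pi1 c (W_region R \<epsilon> \<inter> horseshoe_locus) \<union> {shift})"
  shows "subgroup H Aut_sigma2 \<and> H \<noteq> carrier Aut_sigma2"
proof
  interpret real_HOV c
    using assms by unfold_locales auto
  let ?S = "rho_pi1 c HOV \<union> rho_pi1 c (W_region R \<epsilon> \<inter> horseshoe_locus) \<union> {shift}"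
  have S: "?S \<subseteq> carrier Aut_sigma2"
    using rho_pi1_subset_Aut shift_in_Aut by blast
  then show "subgroup H Aut_sigma2"
    unfolding H_def by (rule group.generate_is_subgroup[OF group_Aut])
  have "parity_respecting \<phi>" if "\<phi> \<in> ?S" for \<phi>
    using that parity_respecting_HOV parity_respecting_W[OF assms(1)] parity_respecting_shift by blast
  then have "parity_respecting \<phi>" if "\<phi> \<in> H" for \<phi>
    using parity_respecting_generate[OF S] that unfolding H_def by blast
  then show "H \<noteq> carrier Aut_sigma2"
    using marker_flip_in_Aut not_parity_respecting_marker_flip by blast
qed

end
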